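(* Let $n>d\ge 1$ be integers, let $X\in\mathbb{R}^{n\times d}$ have full column rank, let $y\in\mathbb{R}^n$ be nonzero, and let $$\beta_{\mathrm{lsr}}=\operatorname{argmin}_{\beta\in\mathbb{R}^d}\|y-X\beta\|_2^2 .$$ Let $\mu$ be the row matrix coherence of $X$, and let $c\le n$ be an integer with $$c\;\ge\;1000\,\mu\,d\,(\ln d+7).$$ Let $S\in\mathbb{R}^{c\times n}$ consist of $c$ rows of the identity matrix $I_n$ chosen uniformly at random without replacement, and let $\tilde\beta_S$ be a solution of the sampled least squares problem $$\tilde\beta_S\in\operatorname{argmin}_{\beta\in\mathbb{R}^d}\|Sy-SX\beta\|_2^2 .$$ Let $\gamma>0$ be such that $\gamma\le \|U_XU_X^Ty\|_2/\|y\|_2\le 1$, if such a $\gamma$ exists. Then with probability at least $0.05$ the following inequalities hold simultaneously: $$\|y-X\tilde\beta_S\|_2^2\;\le\;2.2\,\|y-X\beta_{\mathrm{lsr}}\|_2^2,$$ $$\|\beta_{\mathrm{lsr}}-\tilde\beta_S\|_2^2\;\le\;\frac{1.2}{\sigma_{\min}^2(X)}\,\|y-X\beta_{\mathrm{lsr}}\|_2^2\;\le\;1.2\,\kappa^2(X)\,(\gamma^{-2}-1)\,\|\beta_{\mathrm{lsr}}\|_2^2 ,$$ where the last inequality (the one involving $\gamma$) is asserted for every such $\gamma$.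
   Context: For $X\in\mathbb{R}^{n\times d}$ with $n>d$ and full column rank, the thin singular value decomposition is $X=U_X\Sigma_XV_X^T$ with $U_X\in\mathbb{R}^{n\times d}$ having orthonormal columns, and $\Sigma_X,V_X\in\mathbb{R}^{d\times d}$. $\sigma_{\max}(X)$ and $\sigma_{\min}(X)$ denote the largest and smallest ($d$-th) singular values, and $\kappa(X)=\sigma_{\max}(X)/\sigma_{\min}(X)$. The row matrix coherence of $X$ is $\mu=\frac{n}{d}\max_{1\le i\le n}\|u_X^{(i)}\|_2^2$, where $u_X^{(i)}$ is the $i$-th row of $U_X$. Probabilities are over the uniformly random choice of the $c$-element subset of row indices. If the sampled problem has several minimizers, the assertion is that, on the event in question, the inequalities hold for every minimizer $\tilde\beta_S$. *)

theory Defs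
  imports "HOL-Probability.Probability"
begin

text \<open>
  The singular values are the diagonal entries of \<open>\<Sigma>\<close>. The column index type carries no order,
  so they are not sorted; the largest and the smallest one are obtained by \<^const>\<open>Max\<close> and
  \<^const>\<open>Min\<close>.
\<close>

definition thin_svd ::
    "real^'d^'n \<Rightarrow> real^'d^'n \<Rightarrow> real^'d^'d \<Rightarrow> real^'d^'d \<Rightarrow> bool" where
  "thin_svd X U \<Sigma> V \<longleftrightarrow>
     transpose U ** U = mat 1 \<and>
     (\<forall>i j. i \<noteq> j \<longrightarrow> \<Sigma> $ i $ j = 0) \<and> (\<forall>i. 0 \<le> \<Sigma> $ i $ i) \<and>
     orthogonal_matrix V \<and>
     X = U ** \<Sigma> ** transpose V"

definition sigma_max :: "real^'d^'d \<Rightarrow> real" where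
  "sigma_max \<Sigma> = Max (range (\<lambda>i. \<Sigma> $ i $ i))"

definition sigma_min :: "real^'d^'d \<Rightarrow> real" where
  "sigma_min \<Sigma> = Min (range (\<lambda>i. \<Sigma> $ i $ i))"

definition cond_number :: "real^'d^'d \<Rightarrow> real" where
  "cond_number \<Sigma> = sigma_max \<Sigma> / sigma_min \<Sigma>"

text \<open>The argument is the left factor \<open>U\<close> of a thin singular value decomposition.\<close>

definition row_coherence :: "real^'d^'n \<Rightarrow> real" where
  "row_coherence U = real CARD('n) / real CARD('d) * Max (range (\<lambda>i. (norm (row i U))\<^sup>2))"

definition lsq_solution :: "real^'d^'m \<Rightarrow> real^'m \<Rightarrow> real^'d \<Rightarrow> bool" where
  "lsq_solution A b \<beta> \<longleftrightarrow> is_arg_min (\<lambda>\<beta>. (norm (b - A *v \<beta>))\<^sup>2) (\<lambda>_. True) \<beta>"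

text \<open>
  The \<open>c \<times> n\<close> matrix whose rows are the rows of the identity with index in \<open>J\<close>, where
  \<open>c = CARD('c) = card J\<close>. The order of the rows is left to the choice operator: it does not affect
  the sampled least squares problem.
\<close>

definition sampling_matrix :: "'n set \<Rightarrow> real^'n^'c" where
  "sampling_matrix J = (let f = (SOME f. bij_betw f (UNIV :: 'c set) J) in \<chi> k. row (f k) (mat 1))"

text \<open>The following lemmas show that every matrix of full column rank has a thin singular value
  decomposition; several decompositions may exist.\<close>

lemma symmetric_eigenvector:
  fixes A :: "real^'d^'d"
  assumes sym: "transpose A = A" and W: "subspace W" and inv: "\<And>w. w \<in> W \<Longrightarrow> A *v w \<in> W"
    and ne: "\<exists>w\<in>W. w \<noteq> 0"
  shows "\<exists>v\<in>W. norm v = 1 \<and> (\<exists>l. A *v v = l *\<^sub>R v)"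
proof -
  have symd: "x \<bullet> (A *v y) = (A *v x) \<bullet> y" for x y
    by (metis dot_lmul_matrix sym transpose_matrix_vector)
  have comp: "compact (W \<inter> sphere 0 1)"
    using closed_subspace[OF W] by (simp add: closed_Int_compact)
  obtain w where w: "w \<in> W" "w \<noteq> 0" using ne by blast
  have "w /\<^sub>R norm w \<in> W \<inter> sphere 0 1"
    using w W by (simp add: subspace_scale)
  then have non: "W \<inter> sphere 0 1 \<noteq> {}" by blast
  have "continuous_on (W \<inter> sphere 0 1) (\<lambda>x. x \<bullet> (A *v x))"
    by (intro continuous_intros matrix_vector_mult_linear_continuous_on)
  from continuous_attains_sup[OF comp non this] obtain v
    where v: "v \<in> W" "norm v = 1"
      and mx: "\<And>x. x \<in> W \<Longrightarrow> norm x = 1 \<Longrightarrow> x \<bullet> (A *v x) \<le> v \<bullet> (A *v v)"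
    by auto
  define l where "l = v \<bullet> (A *v v)"
  have vv: "v \<bullet> v = 1" using v by (simp add: dot_square_norm)
  have bound: "x \<bullet> (A *v x) \<le> l * (x \<bullet> x)" if "x \<in> W" for x
  proof (cases "x = 0")
    case False
    let ?u = "x /\<^sub>R norm x"
    have "?u \<bullet> (A *v ?u) \<le> l"
      unfolding l_def using that False W by (intro mx) (simp_all add: subspace_scale)
    then have "(x \<bullet> (A *v x)) / (norm x)\<^sup>2 \<le> l"
      by (simp add: matrix_vector_mult_scaleR power2_eq_square divide_inverse mult.commute mult.left_commute)
    then show ?thesis
      using False by (simp add: dot_square_norm divide_le_eq)
  qed simp
  have orth: "w \<bullet> (A *v v) = 0" if "w \<in> W" "v \<bullet> w = 0" for w
  proof (rule ccontr)
    assume ne0: "w \<bullet> (A *v v) \<noteq> 0"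
    define a where "a = w \<bullet> (A *v v)"
    define b where "b = l * (w \<bullet> w) - w \<bullet> (A *v w)"
    have key: "2 * t * a \<le> t\<^sup>2 * b" for t
    proof -
      have 1: "(v + t *\<^sub>R w) \<bullet> (A *v (v + t *\<^sub>R w)) \<le> l * ((v + t *\<^sub>R w) \<bullet> (v + t *\<^sub>R w))"
        by (rule bound) (use v that W in \<open>simp add: subspace_add subspace_scale\<close>)
      have 2: "(v + t *\<^sub>R w) \<bullet> (A *v (v + t *\<^sub>R w)) = l + 2 * t * a + t\<^sup>2 * (w \<bullet> (A *v w))"
        using symd[of v w] by (simp add: matrix_vector_mult_scaleR matrix_vector_right_distrib
            inner_add_left inner_add_right l_def a_def power2_eq_square inner_commute algebra_simps)
      have 3: "(v + t *\<^sub>R w) \<bullet> (v + t *\<^sub>R w) = 1 + t\<^sup>2 * (w \<bullet> w)"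
        using that vv by (simp add: inner_add_left inner_add_right power2_eq_square inner_commute)
      have "l + 2 * t * a + t\<^sup>2 * (w \<bullet> (A *v w)) \<le> l * (1 + t\<^sup>2 * (w \<bullet> w))"
        using 1 unfolding 2 3 .
      then show ?thesis by (simp add: b_def algebra_simps)
    qed
    have "0 \<le> b" using key[of 1] key[of "-1"] by simp
    define c where "c = a / (b + 1)"
    have ac: "a = c * (b + 1)" using \<open>0 \<le> b\<close> by (simp add: c_def)
    have "c\<^sup>2 * (b + 2) \<le> 0"
      using key[of c] by (simp add: ac power2_eq_square algebra_simps)
    moreover have "0 < c\<^sup>2 * (b + 2)"
      using ne0 \<open>0 \<le> b\<close> ac a_def by (auto intro!: mult_pos_pos)
    ultimately show False by simp
  qed
  let ?r = "A *v v - l *\<^sub>R v"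
  have rW: "?r \<in> W" using v W inv by (simp add: subspace_diff subspace_scale)
  have vr: "v \<bullet> ?r = 0" using vv by (simp add: inner_diff_right l_def)
  have "?r \<bullet> ?r = ?r \<bullet> (A *v v) - l * (v \<bullet> ?r)"
    by (simp add: inner_diff_right inner_diff_left inner_commute algebra_simps)
  also have "\<dots> = 0" using orth[OF rW vr] vr by simp
  finally have "A *v v = l *\<^sub>R v" by simp
  then show ?thesis using v by blast
qed

lemma symmetric_eigenbasis_subspace:
  fixes A :: "real^'d^'d"
  assumes sym: "transpose A = A" and "subspace W" and "\<And>w. w \<in> W \<Longrightarrow> A *v w \<in> W"
  shows "\<exists>B. B \<subseteq> W \<and> finite B \<and> card B = dim W \<and> pairwise orthogonal B \<and>
     (\<forall>v\<in>B. norm v = 1 \<and> (\<exists>l. A *v v = l *\<^sub>R v))"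
  using assms(2,3)
proof (induction "dim W" arbitrary: W)
  case 0
  then show ?case by (intro exI[of _ "{}"]) simp
next
  case (Suc k)
  have symd: "x \<bullet> (A *v y) = (A *v x) \<bullet> y" for x y
    by (metis dot_lmul_matrix sym transpose_matrix_vector)
  have "\<exists>w\<in>W. w \<noteq> 0" using Suc.hyps(2) by (metis dim_eq_0 nat.simps(3) singletonI subsetI)
  then obtain v l where v: "v \<in> W" "norm v = 1" "A *v v = l *\<^sub>R v"
    using symmetric_eigenvector[OF sym Suc.prems] by blast
  define W' where "W' = {y \<in> W. \<forall>x \<in> span {v}. orthogonal x y}"
  have W'_alt: "W' = {y \<in> W. v \<bullet> y = 0}"
    by (auto simp: W'_def orthogonal_def span_singleton)
  have "dim W' + dim (span {v}) = dim W"
    unfolding W'_def using v Suc.prems(1)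
    by (intro dim_subspace_orthogonal_to_vectors) (auto intro: span_minimal simp: span_minimal)
  moreover have "dim (span {v}) = 1" using v by (metis dim_span dim_singleton norm_zero zero_neq_one)
  ultimately have dimW': "k = dim W'" using Suc.hyps(2) by simp
  have sub: "subspace W'"
    using Suc.prems(1) by (auto simp: W'_alt subspace_def inner_add_right)
  have inv: "A *v w \<in> W'" if "w \<in> W'" for w
    using that Suc.prems(2) symd[of v w] v by (auto simp: W'_alt)
  obtain B where B: "B \<subseteq> W'" "finite B" "card B = dim W'" "pairwise orthogonal B"
      "\<forall>v\<in>B. norm v = 1 \<and> (\<exists>l. A *v v = l *\<^sub>R v)"
    using Suc.hyps(1)[OF dimW' sub inv] by blast
  have "v \<notin> B" using B(1) v by (auto simp: W'_alt dot_square_norm)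
  moreover have "pairwise orthogonal (insert v B)"
    using B(1,4) by (auto simp: pairwise_insert W'_alt orthogonal_def inner_commute)
  ultimately show ?case
    using B v Suc.hyps(2) dimW' by (intro exI[of _ "insert v B"]) (auto simp: W'_alt)
qed

lemma thin_svd_exists:
  fixes X :: "real^'d^'n"
  assumes "rank X = CARD('d)"
  shows "\<exists>U \<Sigma> V. thin_svd X U \<Sigma> V"
proof -
  define A where "A = transpose X ** X"
  have sym: "transpose A = A" by (simp add: A_def matrix_transpose_mul)
  obtain B :: "(real^'d) set" where B: "finite B" "card B = CARD('d)" "pairwise orthogonal B"
      "\<forall>v\<in>B. norm v = 1 \<and> (\<exists>l. A *v v = l *\<^sub>R v)"
    using symmetric_eigenbasis_subspace[OF sym subspace_UNIV] by auto
  obtain b where b: "bij_betw b (UNIV :: 'd set) B"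
    using B by (metis finite_same_card_bij finite_class.finite_UNIV)
  have bB: "b i \<in> B" for i using b by (auto simp: bij_betw_def)
  have bo: "b i \<bullet> b j = (if i = j then 1 else 0)" for i j
  proof (cases "i = j")
    case True
    then show ?thesis using B(4) bB by (simp add: dot_square_norm)
  next
    case False
    then have "b i \<noteq> b j" using b by (auto simp: bij_betw_def inj_def)
    then show ?thesis using B(3) bB False by (auto simp: pairwise_def orthogonal_def)
  qed
  have nz: "X *v b i \<noteq> 0" for i
  proof
    assume "X *v b i = 0"
    moreover have "inj ((*v) X)" using assms full_rank_injective by blast
    ultimately have "b i = 0" by (metis injD matrix_vector_mult_0_right)
    then show False using bo[of i i] by simp
  qed
  define s where "s i = norm (X *v b i)" for i
  have s: "s i > 0" for i using nz by (simp add: s_def)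
  have Xo: "(X *v b i) \<bullet> (X *v b j) = 0" if "i \<noteq> j" for i j
  proof -
    obtain l where "A *v b j = l *\<^sub>R b j" using B(4) bB by blast
    then have "b i \<bullet> (A *v b j) = 0" using bo that by simp
    then show ?thesis
      by (metis A_def dot_lmul_matrix inner_commute matrix_vector_mul_assoc transpose_matrix_vector)
  qed
  define V :: "real^'d^'d" where "V = (\<chi> i j. b j $ i)"
  define S :: "real^'d^'d" where "S = (\<chi> i j. if i = j then s i else 0)"
  define U :: "real^'d^'n" where "U = (\<chi> i j. (X *v b j) $ i / s j)"
  have oV: "orthogonal_matrix V"
    unfolding orthogonal_matrix using bo
    by (simp add: V_def vec_eq_iff matrix_matrix_mult_def transpose_def mat_def inner_vec_def)
  have "transpose U ** U = mat 1"
  proof -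
    have "(transpose U ** U) $ i $ j = ((X *v b i) \<bullet> (X *v b j)) / (s i * s j)" for i j
      by (simp add: U_def matrix_matrix_mult_def transpose_def inner_vec_def sum_divide_distrib)
    moreover have "(X *v b i) \<bullet> (X *v b i) = s i * s i" for i
      by (simp add: s_def dot_square_norm power2_eq_square)
    ultimately show ?thesis
      using Xo s by (simp add: vec_eq_iff mat_def less_imp_neq[symmetric])
  qed
  moreover have "X = U ** S ** transpose V"
  proof -
    have "U ** S = X ** V"
    proof -
      have "U $ i $ k * S $ k $ j = (if k = j then U $ i $ k * s k else 0)" for i j k
        by (simp add: S_def)
      then have "(U ** S) $ i $ j = (\<Sum>k\<in>UNIV. if k = j then U $ i $ k * s k else 0)" for i j
        by (simp only: matrix_matrix_mult_def vec_lambda_beta)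
      then have "(U ** S) $ i $ j = (X *v b j) $ i" for i j
        using s[of j] by (simp add: U_def)
      moreover have "(X ** V) $ i $ j = (X *v b j) $ i" for i j
        by (simp add: matrix_matrix_mult_def matrix_vector_mult_def V_def)
      ultimately show ?thesis by (simp add: vec_eq_iff)
    qed
    then have "U ** S ** transpose V = X ** (V ** transpose V)"
      by (simp add: matrix_mul_assoc)
    then show ?thesis using oV by (simp add: orthogonal_matrix_def)
  qed
  moreover have "\<forall>i j. i \<noteq> j \<longrightarrow> S $ i $ j = 0" "\<forall>i. 0 \<le> S $ i $ i"
    using s by (auto simp: S_def less_imp_le)
  ultimately show ?thesis using oV unfolding thin_svd_def by blast
qed

end

theory Submission
  imports Defs
begin

text \<open>
  Let \<open>u\<^sub>i\<close> be the rows of \<open>U\<close>, \<open>r\<close> the residual of the full problem and \<open>b = max |u\<^sub>i|\<^sup>2\<close>. The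
  fitted values of a sampled solution differ from the optimal ones by \<open>U w\<close>, and the normal equations
  of the sampled problem on \<open>J\<close> read \<open>A\<^sub>J w = g\<^sub>J\<close> with \<open>A\<^sub>J = \<Sum>\<^sub>i\<^sub>\<in>\<^sub>J u\<^sub>i u\<^sub>i\<^sup>T\<close> and
  \<open>g\<^sub>J = \<Sum>\<^sub>i\<^sub>\<in>\<^sub>J r\<^sub>i u\<^sub>i\<close>. A second moment bound controls \<open>g\<^sub>J\<close>, because \<open>U\<^sup>T r = 0\<close>.

  The matrix Chernoff bound \<open>A\<^sub>J \<ge> c / (8 n)\<close> is obtained without matrix exponentials, from the potential
  \<open>tr N\<^sub>J\<^sup>m\<close>, where \<open>N\<^sub>J = I - A\<^sub>J\<close> and \<open>m\<close> is about \<open>1 / (8 b)\<close>. As \<open>N\<^sub>J\<close> is the sum of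
  \<open>u\<^sub>i u\<^sub>i\<^sup>T\<close> over the rows not yet sampled, the mean decrease of the potential in the next step is, to first
  order, \<open>m / (n - |J|)\<close> times the potential itself; sampling without replacement is thus handled
  exactly. The second-order term is bounded by log-convexity of the moments \<open>u \<bullet> N\<^sup>k u\<close>.
\<close>

subsection \<open>Traces of powers of positive semidefinite matrices\<close>

primrec mat_power :: "real^'d^'d \<Rightarrow> nat \<Rightarrow> real^'d^'d" where
  "mat_power A 0 = mat 1"
| "mat_power A (Suc k) = A ** mat_power A k"

definition outer :: "real^'d \<Rightarrow> real^'d^'d" where
  "outer u = (\<chi> i j. u $ i * u $ j)"

definition psd :: "real^'d^'d \<Rightarrow> bool" where
  "psd A \<longleftrightarrow> transpose A = A \<and> (\<forall>x. 0 \<le> x \<bullet> (A *v x))"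

lemma inner_symmetric:
  fixes A :: "real^'d^'d"
  assumes "transpose A = A"
  shows "x \<bullet> (A *v y) = (A *v x) \<bullet> y"
  by (metis assms dot_lmul_matrix transpose_matrix_vector)

lemma mat_power_commute: "mat_power A k ** A = A ** mat_power A k"
  by (induction k) (auto simp: matrix_mul_assoc[symmetric])

lemma mat_power_add: "mat_power A (j + k) = mat_power A j ** mat_power A k"
  by (induction j) (auto simp: matrix_mul_assoc[symmetric])

lemma inner_mat_power:
  fixes A :: "real^'d^'d"
  assumes "transpose A = A"
  shows "x \<bullet> (mat_power A k *v y) = (mat_power A k *v x) \<bullet> y"
proof (induction k arbitrary: x y)
  case (Suc k)
  have "x \<bullet> (mat_power A (Suc k) *v y) = (A *v x) \<bullet> (mat_power A k *v y)"
    by (simp add: inner_symmetric[OF assms] matrix_vector_mul_assoc[symmetric])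
  also have "\<dots> = ((mat_power A k ** A) *v x) \<bullet> y"
    by (simp add: Suc matrix_vector_mul_assoc[symmetric])
  finally show ?case by (simp add: mat_power_commute)
qed simp

lemma outer_mult_vec: "outer u *v x = (u \<bullet> x) *\<^sub>R u"
  by (simp add: outer_def matrix_vector_mult_def vec_eq_iff inner_vec_def sum_distrib_left
      sum_distrib_right mult_ac)

lemma transpose_outer: "transpose (outer u) = outer u"
  by (simp add: outer_def transpose_def vec_eq_iff mult.commute)

lemma transpose_sum: "transpose (\<Sum>i\<in>I. f i) = (\<Sum>i\<in>I. transpose (f i :: real^'n^'m))"
  by (simp add: transpose_def vec_eq_iff)

lemma sum_mult_vec: "(\<Sum>i\<in>I. f i :: real^'n^'m) *v x = (\<Sum>i\<in>I. f i *v x)"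
  by (induction I rule: infinite_finite_induct) (simp_all add: matrix_vector_mult_add_rdistrib)

lemma sum_matrix_mult: "(\<Sum>i\<in>I. f i :: real^'n^'m) ** B = (\<Sum>i\<in>I. f i ** B)"
  by (simp add: matrix_eq sum_mult_vec flip: matrix_vector_mul_assoc)

lemma trace_sum: "trace (\<Sum>i\<in>I. f i) = (\<Sum>i\<in>I. trace (f i :: real^'n^'n))"
  unfolding trace_def sum_component by (rule sum.swap)

lemma trace_outer_mult: "trace (outer u ** A) = u \<bullet> (A *v u)"
proof -
  have "trace (outer u ** A) = (\<Sum>i\<in>UNIV. \<Sum>k\<in>UNIV. u $ k * (u $ i * A $ k $ i))"
    by (simp add: trace_def outer_def matrix_matrix_mult_def mult_ac)
  also have "\<dots> = u \<bullet> (A *v u)"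
    by (subst sum.swap) (simp add: matrix_vector_mult_def inner_vec_def sum_distrib_left mult_ac)
  finally show ?thesis .
qed

lemma trace_scaleR: "trace (c *\<^sub>R A) = c * trace (A :: real^'n^'n)"
  by (simp add: trace_def sum_distrib_left)

lemma trace_outer: "trace (outer u) = u \<bullet> u"
  using trace_outer_mult[of u "mat 1"] by simp

text \<open>Half of the factors can be moved across the inner product. This leaves a squared norm
  for an even exponent, and the quadratic form of \<open>A\<close> at
  \<open>mat_power A j *v x\<close> for an odd one.\<close>

lemma mat_power_nonneg:
  assumes "psd A"
  shows "0 \<le> x \<bullet> (mat_power A k *v x)"
proof -
  have sym: "transpose A = A" and pos: "\<And>x. 0 \<le> x \<bullet> (A *v x)"
    using assms by (auto simp: psd_def)
  obtain j where "k = j + j \<or> k = j + Suc j"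
    by (metis add_Suc_right evenE mult_2 oddE Suc_eq_plus1)
  then show ?thesis
  proof
    assume "k = j + j"
    then have "x \<bullet> (mat_power A k *v x) = (mat_power A j *v x) \<bullet> (mat_power A j *v x)"
      by (simp add: mat_power_add inner_mat_power[OF sym] flip: matrix_vector_mul_assoc)
    then show ?thesis by simp
  next
    assume "k = j + Suc j"
    then have "mat_power A k = mat_power A j ** (A ** mat_power A j)"
      by (metis mat_power.simps(2) mat_power_add)
    then have "x \<bullet> (mat_power A k *v x) = x \<bullet> (mat_power A j *v (A *v (mat_power A j *v x)))"
      by (simp flip: matrix_vector_mul_assoc)
    also have "\<dots> = (mat_power A j *v x) \<bullet> (A *v (mat_power A j *v x))"
      by (rule inner_mat_power[OF sym])
    finally have "x \<bullet> (mat_power A k *v x) = (mat_power A j *v x) \<bullet> (A *v (mat_power A j *v x))" .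
    then show ?thesis using pos by simp
  qed
qed

text \<open>Reduces the later inequalities on traces and moments to scalar ones: the
  \<open>l b\<close> are nonnegative eigenvalues and the \<open>(x \<bullet> b)\<^sup>2\<close> act
  as weights. The case \<open>k = 0\<close> is Parseval's identity.\<close>

lemma psd_spectral:
  fixes A :: "real^'d^'d"
  assumes "psd A"
  shows "\<exists>(B :: (real^'d) set) l. finite B \<and> card B = CARD('d) \<and> (\<forall>b\<in>B. 0 \<le> l b) \<and>
    (\<forall>k. trace (mat_power A k) = (\<Sum>b\<in>B. l b ^ k)) \<and>
    (\<forall>x k. x \<bullet> (mat_power A k *v x) = (\<Sum>b\<in>B. l b ^ k * (x \<bullet> b)\<^sup>2))"
proof -
  have sym: "transpose A = A" and pos: "\<And>x. 0 \<le> x \<bullet> (A *v x)"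
    using assms by (auto simp: psd_def)
  obtain B :: "(real^'d) set" where B: "finite B" "card B = CARD('d)" "pairwise orthogonal B"
      "\<forall>v\<in>B. norm v = 1 \<and> (\<exists>l. A *v v = l *\<^sub>R v)"
    using symmetric_eigenbasis_subspace[OF sym subspace_UNIV] by auto
  obtain l where l: "\<And>v. v \<in> B \<Longrightarrow> A *v v = l v *\<^sub>R v" using B(4) by metis
  have "independent B"
    using B(3,4) by (intro pairwise_orthogonal_independent) auto
  then have "span B = UNIV"
    using card_ge_dim_independent[of B UNIV] B(2) by auto
  then have ex: "(\<Sum>b\<in>B. (x \<bullet> b) *\<^sub>R b) = x" for x
    using B by (intro orthonormal_basis_expand) auto
  have pw: "mat_power A k *v b = (l b ^ k) *\<^sub>R b" if "b \<in> B" for k b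
    using that by (induction k)
      (simp_all add: l matrix_vector_mult_scaleR mult.commute flip: matrix_vector_mul_assoc)
  have act: "mat_power A k *v x = (\<Sum>b\<in>B. (l b ^ k * (x \<bullet> b)) *\<^sub>R b)" for k x
  proof -
    have "mat_power A k *v x = mat_power A k *v (\<Sum>b\<in>B. (x \<bullet> b) *\<^sub>R b)" by (simp add: ex)
    also have "\<dots> = (\<Sum>b\<in>B. (l b ^ k * (x \<bullet> b)) *\<^sub>R b)"
      by (simp add: linear_sum[OF matrix_vector_mul_linear] matrix_vector_mult_scaleR pw mult.commute)
    finally show ?thesis .
  qed
  have mat: "mat_power A k = (\<Sum>b\<in>B. (l b ^ k) *\<^sub>R outer b)" for k
    by (simp add: matrix_eq act sum_mult_vec outer_mult_vec inner_commute flip: scaleR_matrix_vector_assoc)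
  show ?thesis
  proof (intro exI conjI ballI allI)
    show "0 \<le> l b" if "b \<in> B" for b
      using pos[of b] B(4) that by (simp add: l dot_square_norm)
    show "trace (mat_power A k) = (\<Sum>b\<in>B. l b ^ k)" for k
      using B(4) by (simp add: mat trace_sum trace_scaleR trace_outer dot_square_norm)
    show "x \<bullet> (mat_power A k *v x) = (\<Sum>b\<in>B. l b ^ k * (x \<bullet> b)\<^sup>2)" for x k
      by (simp add: act inner_sum_right power2_eq_square mult.assoc)
  qed (use B in auto)
qed

text \<open>Chebyshev's sum inequality for the eigenvalues with weights \<open>w b\<close>: their
  \<open>j\<close>-th and \<open>k\<close>-th powers are ordered alike, so every product of
  differences in the double sum is nonnegative.\<close>

lemma mat_power_moments:
  fixes A :: "real^'d^'d"
  assumes "psd A"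
  shows "(x \<bullet> (mat_power A j *v x)) * (x \<bullet> (mat_power A k *v x))
    \<le> (x \<bullet> x) * (x \<bullet> (mat_power A (j + k) *v x))"
proof -
  obtain B :: "(real^'d) set" and l where B: "finite B" "card B = CARD('d)" "\<And>b. b \<in> B \<Longrightarrow> 0 \<le> l b"
    and t: "\<And>k. trace (mat_power A k) = (\<Sum>b\<in>B. l b ^ k)"
    and q: "\<And>x k. x \<bullet> (mat_power A k *v x) = (\<Sum>b\<in>B. l b ^ k * (x \<bullet> b)\<^sup>2)"
    using psd_spectral[OF assms] by blast
  define w where "w b = (x \<bullet> b)\<^sup>2" for b
  have pos: "0 \<le> (l a ^ j - l b ^ j) * (l a ^ k - l b ^ k)" if "a \<in> B" "b \<in> B" for a b
  proof (cases "l a \<le> l b")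
    case True
    then show ?thesis using B that by (intro mult_nonpos_nonpos) (auto intro: power_mono)
  next
    case False
    then show ?thesis using B that by (intro mult_nonneg_nonneg) (auto intro: power_mono)
  qed
  have "0 \<le> (\<Sum>a\<in>B. \<Sum>b\<in>B. w a * w b * ((l a ^ j - l b ^ j) * (l a ^ k - l b ^ k)))"
    by (intro sum_nonneg mult_nonneg_nonneg[OF mult_nonneg_nonneg pos]) (auto simp: w_def)
  also have "\<dots> = (\<Sum>a\<in>B. \<Sum>b\<in>B. (l a ^ (j + k) * w a) * w b + w a * (l b ^ (j + k) * w b)
       - (l a ^ j * w a) * (l b ^ k * w b) - (l a ^ k * w a) * (l b ^ j * w b))"
    by (intro sum.cong) (auto simp: power_add algebra_simps)
  also have "\<dots> = 2 * (sum w B * (\<Sum>b\<in>B. l b ^ (j + k) * w b)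
      - (\<Sum>b\<in>B. l b ^ j * w b) * (\<Sum>b\<in>B. l b ^ k * w b))"
    by (simp only: sum.distrib sum_subtractf flip: sum_product) (simp add: algebra_simps)
  finally show ?thesis
    using q[of x 0] by (simp add: q w_def)
qed

lemma trace_mat_power_nonneg: "psd A \<Longrightarrow> 0 \<le> trace (mat_power A k)"
  using psd_spectral[of A] by (auto intro!: sum_nonneg)

text \<open>An eigenvalue above 1/4 loses at most a factor 4 when one more power is taken; each of
  the others contributes at most \<open>1 / 4 ^ k\<close>.\<close>

lemma trace_mat_power_pred_le:
  fixes A :: "real^'d^'d"
  assumes "psd A"
  shows "trace (mat_power A k) \<le> 4 * trace (mat_power A (Suc k)) + CARD('d) / 4 ^ k"
proof -
  obtain B :: "(real^'d) set" and l where B: "finite B" "card B = CARD('d)" "\<And>b. b \<in> B \<Longrightarrow> 0 \<le> l b"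
    and t: "\<And>k. trace (mat_power A k) = (\<Sum>b\<in>B. l b ^ k)"
    and q: "\<And>x k. x \<bullet> (mat_power A k *v x) = (\<Sum>b\<in>B. l b ^ k * (x \<bullet> b)\<^sup>2)"
    using psd_spectral[OF assms] by blast
  have "l b ^ k \<le> 4 * l b ^ Suc k + (1 / 4) ^ k" if "b \<in> B" for b
  proof (cases "l b \<le> 1 / 4")
    case True
    then have "l b ^ k \<le> (1 / 4) ^ k" using B that by (intro power_mono) auto
    moreover have "0 \<le> 4 * l b ^ Suc k" using B(3)[OF that] by simp
    ultimately show ?thesis by linarith
  next
    case False
    then have "1 * l b ^ k \<le> (4 * l b) * l b ^ k"
      using B(3)[OF that] by (intro mult_right_mono) auto
    then show ?thesis by (simp add: add_increasing2)
  qed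
  then have "(\<Sum>b\<in>B. l b ^ k) \<le> (\<Sum>b\<in>B. 4 * l b ^ Suc k + (1 / 4) ^ k)"
    by (rule sum_mono)
  then show ?thesis
    using B by (simp add: t sum.distrib sum_distrib_left power_divide del: mat_power.simps)
qed

text \<open>At a unit vector the quadratic form is a weighted mean of the eigenvalues, so some
  eigenvalue is at least \<open>s\<close>. Its power is one of the nonnegative summands of the
  trace.\<close>

lemma quadratic_form_le_trace:
  fixes A :: "real^'d^'d"
  assumes "psd A" "norm x = 1" "0 \<le> s" "s \<le> x \<bullet> (A *v x)"
  shows "s ^ k \<le> trace (mat_power A k)"
proof -
  obtain B :: "(real^'d) set" and l where B: "finite B" "card B = CARD('d)" "\<And>b. b \<in> B \<Longrightarrow> 0 \<le> l b"
    and t: "\<And>k. trace (mat_power A k) = (\<Sum>b\<in>B. l b ^ k)"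
    and q: "\<And>x k. x \<bullet> (mat_power A k *v x) = (\<Sum>b\<in>B. l b ^ k * (x \<bullet> b)\<^sup>2)"
    using psd_spectral[OF assms(1)] by blast
  have one: "(\<Sum>b\<in>B. (x \<bullet> b)\<^sup>2) = 1"
    using q[of x 0] assms(2) by (simp add: dot_square_norm)
  have "\<exists>b\<in>B. s \<le> l b"
  proof (rule ccontr)
    assume "\<not> ?thesis"
    then have less: "l b < s" if "b \<in> B" for b using that by force
    have "\<exists>b\<in>B. (x \<bullet> b)\<^sup>2 \<noteq> 0" using one by (metis sum.neutral zero_neq_one)
    then obtain b where b: "b \<in> B" "(x \<bullet> b)\<^sup>2 > 0" by auto
    have "x \<bullet> (A *v x) = (\<Sum>b\<in>B. l b * (x \<bullet> b)\<^sup>2)" using q[of x 1] by simp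
    also have "\<dots> < (\<Sum>b\<in>B. s * (x \<bullet> b)\<^sup>2)"
      using B(1) b less
      by (intro sum_strict_mono_ex1) (auto intro!: mult_right_mono bexI[of _ b] intro: less_imp_le)
    also have "\<dots> = s" by (simp add: one flip: sum_distrib_left)
    finally show False using assms(4) by simp
  qed
  then obtain b where b: "b \<in> B" "s \<le> l b" by blast
  have "s ^ k \<le> l b ^ k" using b assms(3) by (intro power_mono)
  also have "\<dots> \<le> (\<Sum>b\<in>B. l b ^ k)"
    using B b by (intro member_le_sum) auto
  finally show ?thesis by (simp add: t)
qed

section \<open>Effect of a rank-one update on the trace of a power\<close>

lemma trace_mat_power_diff:
  assumes "N = M + outer u"
  shows "trace (mat_power N m) - trace (mat_power M m)
    = (\<Sum>k<m. u \<bullet> (mat_power M k *v (mat_power N (m - 1 - k) *v u)))"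
proof -
  \<comment> \<open>Telescoping: the factors \<open>N\<close> are exchanged for \<open>M\<close> one
    at a time from the right, and each exchange leaves one \<open>outer u\<close>. Cyclicity of the
    trace then turns every term into a mixed moment.\<close>
  have "mat_power N m - mat_power M m
      = (\<Sum>k<m. mat_power N (m - 1 - k) ** outer u ** mat_power M k)"
  proof (induction m)
    case (Suc m)
    have "mat_power N (Suc m) - mat_power M (Suc m)
        = N ** (mat_power N m - mat_power M m) + outer u ** mat_power M m"
      by (simp add: assms matrix_eq matrix_vector_mult_diff_distrib matrix_vector_mult_add_rdistrib
          matrix_vector_mult_diff_rdistrib flip: matrix_vector_mul_assoc)
    also have "N ** (mat_power N m - mat_power M m)
        = (\<Sum>k<m. mat_power N (m - k) ** outer u ** mat_power M k)"
    proof -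
      have "N ** (\<Sum>k<m. mat_power N (m - 1 - k) ** outer u ** mat_power M k)
        = (\<Sum>k<m. N ** (mat_power N (m - 1 - k) ** outer u ** mat_power M k))"
        by (simp add: matrix_eq sum_mult_vec linear_sum[OF matrix_vector_mul_linear]
            flip: matrix_vector_mul_assoc)
      also have "\<dots> = (\<Sum>k<m. mat_power N (m - k) ** outer u ** mat_power M k)"
      proof (intro sum.cong refl)
        fix k assume "k \<in> {..<m}"
        then have "m - k = Suc (m - 1 - k)" by auto
        then show "N ** (mat_power N (m - 1 - k) ** outer u ** mat_power M k)
            = mat_power N (m - k) ** outer u ** mat_power M k"
          by (simp add: matrix_mul_assoc)
      qed
      finally show ?thesis using Suc by simp
    qed
    finally show ?case by simp
  qed simp
  then have "trace (mat_power N m) - trace (mat_power M m)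
      = (\<Sum>k<m. trace (mat_power N (m - 1 - k) ** (outer u ** mat_power M k)))"
    by (simp only: trace_sum matrix_mul_assoc flip: trace_sub)
  also have "\<dots> = (\<Sum>k<m. trace (outer u ** (mat_power M k ** mat_power N (m - 1 - k))))"
    by (subst trace_mul_sym) (simp add: matrix_mul_assoc)
  finally show ?thesis
    by (simp add: trace_outer_mult flip: matrix_vector_mul_assoc)
qed

text \<open>In the mixed moments \<open>q k j\<close>, exchanging a factor \<open>M\<close> for
  \<open>N\<close> costs at most \<open>b\<close> times the moment of \<open>N\<close> of total
  order one lower. The \<open>k\<close>-th term of the telescoping sum needs \<open>k\<close>
  exchanges, and adding up the costs gives the second-order coefficient. The exponent
  \<open>Suc (Suc m)\<close> avoids subtraction in the orders of the two moments.\<close>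

lemma trace_mat_power_rank_one_update:
  assumes N: "psd N" "psd M" "N = M + outer u" and b: "u \<bullet> u \<le> b"
  shows "trace (mat_power M (Suc (Suc m))) \<le> trace (mat_power N (Suc (Suc m)))
    - real (Suc (Suc m)) * (u \<bullet> (mat_power N (Suc m) *v u))
    + real (Suc (Suc m)) * real (Suc m) / 2 * b * (u \<bullet> (mat_power N m *v u))"
proof -
  define n where "n j = u \<bullet> (mat_power N j *v u)" for j
  define q where "q k j = u \<bullet> (mat_power M k *v (mat_power N j *v u))" for k j
  have n0: "0 \<le> n j" for j unfolding n_def by (rule mat_power_nonneg[OF N(1)])
  have q0: "0 \<le> q k 0" for k unfolding q_def using mat_power_nonneg[OF N(2)] by simp
  \<comment> \<open>The rightmost \<open>M\<close> is replaced by \<open>N\<close> minus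
    \<open>outer u\<close>; the rank-one part splits the form into a product of two moments.\<close>
  have rec: "q (Suc k) j = q k (Suc j) - q k 0 * n j" for k j
  proof -
    have "q (Suc k) j = u \<bullet> (mat_power M k *v (M *v (mat_power N j *v u)))"
      unfolding q_def by (simp add: matrix_vector_mul_assoc matrix_mul_assoc mat_power_commute)
    also have "M *v (mat_power N j *v u) = mat_power N (Suc j) *v u - n j *\<^sub>R u"
    proof -
      have "N *v x = M *v x + (u \<bullet> x) *\<^sub>R u" for x
        using N(3) by (simp add: matrix_vector_mult_add_rdistrib outer_mult_vec)
      then show ?thesis by (simp add: n_def flip: matrix_vector_mul_assoc)
    qed
    finally show ?thesis
      by (simp add: q_def matrix_vector_mult_diff_distrib matrix_vector_mult_scaleR inner_diff_right
          mult.commute)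
  qed
  have up: "q k j \<le> n (k + j)" for k j
  proof (induction k arbitrary: j)
    case 0 then show ?case by (simp add: q_def n_def)
  next
    case (Suc k)
    have "q (Suc k) j \<le> q k (Suc j)" using rec q0 n0 by simp
    then show ?case using Suc[of "Suc j"] by simp
  qed
  \<comment> \<open>The moment inequality for \<open>N\<close> merges the product into a single
    moment at the price of the zeroth moment \<open>u \<bullet> u\<close>, which is at most
    \<open>b\<close>.\<close>
  have prod: "q k 0 * n j \<le> b * n (k + j)" for k j
  proof -
    have "q k 0 * n j \<le> n k * n j" using up[of k 0] n0 by (simp add: mult_right_mono)
    also have "\<dots> \<le> (u \<bullet> u) * n (k + j)" unfolding n_def by (rule mat_power_moments[OF N(1)])
    also have "\<dots> \<le> b * n (k + j)" using b n0 by (intro mult_right_mono)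
    finally show ?thesis .
  qed
  have low: "n (k + Suc j) - k * b * n (k + j) \<le> q k (Suc j)" for k j
  proof (induction k arbitrary: j)
    case 0 then show ?case by (simp add: q_def n_def)
  next
    case (Suc k)
    show ?case
      using Suc[of "Suc j"] rec[of k "Suc j"] prod[of k "Suc j"] by (simp add: algebra_simps)
  qed
  \<comment> \<open>The last summand contains no power of \<open>N\<close>, whereas
    \<open>low\<close> requires at least one; a further use of \<open>rec\<close> reaches
    it.\<close>
  have low0: "n (Suc m) - Suc m * b * n m \<le> q (Suc m) 0"
    using low[of m 0] rec[of m 0] prod[of m 0] by (simp add: algebra_simps)
  have "(\<Sum>k<Suc (Suc m). n (Suc m) - k * b * n m) \<le> (\<Sum>k<Suc (Suc m). q k (Suc m - k))"
  proof (rule sum_mono)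
    fix k assume k: "k \<in> {..<Suc (Suc m)}"
    show "n (Suc m) - k * b * n m \<le> q k (Suc m - k)"
    proof (cases "k = Suc m")
      case True then show ?thesis using low0 by simp
    next
      case False
      then have "Suc m - k = Suc (m - k)" "k + (m - k) = m" using k by auto
      then show ?thesis using low[of k "m - k"] by simp
    qed
  qed
  also have "(\<Sum>k<Suc (Suc m). q k (Suc m - k))
      = trace (mat_power N (Suc (Suc m))) - trace (mat_power M (Suc (Suc m)))"
    using trace_mat_power_diff[OF N(3), of "Suc (Suc m)"] by (simp add: q_def)
  also have "(\<Sum>k<Suc (Suc m). n (Suc m) - k * b * n m)
      = Suc (Suc m) * n (Suc m) - (\<Sum>k<Suc (Suc m). real k) * (b * n m)"
    unfolding sum_subtractf sum_distrib_right mult.assoc by simp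
  also have "(\<Sum>k<Suc (Suc m). real k) = real (Suc (Suc m)) * real (Suc m) / 2"
    by (induction m) (auto simp: field_simps)
  finally show ?thesis by (simp add: n_def algebra_simps)
qed

subsection \<open>Averages over subsets of fixed size\<close>

text \<open>The expectation over a uniformly random \<open>k\<close>-element subset, kept as a
  finite sum so that passing from \<open>k\<close> to \<open>Suc k\<close> is a counting
  argument.\<close>

definition subset_average :: "nat \<Rightarrow> ('n::finite set \<Rightarrow> real) \<Rightarrow> real" where
  "subset_average k F = (\<Sum>J | card J = k. F J) / (CARD('n) choose k)"

lemma subset_average_0: "subset_average 0 F = F {}"
proof -
  have "{J :: 'a set. card J = 0} = {{}}" by auto
  then show ?thesis by (simp add: subset_average_def)
qed

lemma subset_average_add: "subset_average k (\<lambda>J. F J + G J) = subset_average k F + subset_average k G"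
  by (simp add: subset_average_def sum.distrib add_divide_distrib)

lemma subset_average_cmult: "subset_average k (\<lambda>J. a * F J) = a * subset_average k F"
  by (simp add: subset_average_def flip: sum_distrib_left)

lemma card_subsets_UNIV: "card {J :: 'n::finite set. card J = k} = CARD('n) choose k"
  using n_subsets[of "UNIV :: 'n set" k] by simp

lemma subsets_card_nonempty:
  assumes "k \<le> CARD('n::finite)"
  shows "{J :: 'n set. card J = k} \<noteq> {}"
proof -
  obtain J :: "'n set" where "card J = k" by (rule obtain_subset_with_card_n[OF assms])
  then show ?thesis by blast
qed

lemma subset_average_const:
  assumes "k \<le> CARD('n::finite)"
  shows "subset_average k (\<lambda>J :: 'n set. a) = a"
  using assms by (simp add: subset_average_def card_subsets_UNIV)

lemma subset_average_mono:
  assumes "\<And>J. card J = k \<Longrightarrow> F J \<le> G J"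
  shows "subset_average k F \<le> subset_average k G"
  using assms by (auto simp: subset_average_def intro!: divide_right_mono sum_mono)

lemma of_nat_card_Compl:
  "real (card (- J)) = real CARD('n) - real (card (J :: 'n::finite set))"
  by (simp add: Compl_eq_Diff_UNIV card_Diff_subset of_nat_diff card_mono)

text \<open>Double counting: a set of size \<open>Suc k\<close> arises once for each of its
  elements, taken as the one added last.\<close>

lemma sum_subsets_Suc:
  fixes F :: "'n::finite set \<Rightarrow> real"
  shows "(\<Sum>J | card J = k. \<Sum>i\<in>-J. F (insert i J)) = real (Suc k) * (\<Sum>J | card J = Suc k. F J)"
proof -
  have "(\<Sum>J | card J = k. \<Sum>i\<in>-J. F (insert i J))
      = (\<Sum>(J, i) \<in> Sigma {J. card J = k} (\<lambda>J. - J). F (insert i J))"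
    by (simp add: sum.Sigma)
  also have "\<dots> = (\<Sum>(J, i) \<in> Sigma {J. card J = Suc k} (\<lambda>J. J). F J)"
    by (rule sum.reindex_bij_witness[of _ "\<lambda>(J, i). (J - {i}, i)" "\<lambda>(J, i). (insert i J, i)"])
      auto
  also have "\<dots> = (\<Sum>J | card J = Suc k. \<Sum>i\<in>J. F J)"
    by (rule sum.Sigma[symmetric]) auto
  also have "\<dots> = (\<Sum>J | card J = Suc k. real (Suc k) * F J)"
    by (intro sum.cong) auto
  finally show ?thesis by (simp add: sum_distrib_left)
qed

text \<open>A uniform set of size \<open>k\<close> enlarged by a uniformly chosen new element is a
  uniform set of size \<open>Suc k\<close>. Sampling without replacement thereby becomes a process
  that adds one row at a time.\<close>

lemma subset_average_Suc:
  fixes F :: "'n::finite set \<Rightarrow> real"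
  assumes "k < CARD('n)"
  shows "(real CARD('n) - real k) * subset_average (Suc k) F
    = subset_average k (\<lambda>J. \<Sum>i\<in>-J. F (insert i J))"
proof -
  let ?n = "CARD('n)"
  have "Suc k * (?n choose Suc k) = (?n - k) * (?n choose k)"
    using binomial_absorb_comp[of ?n k] binomial_absorption[of k "?n"] assms
    by (metis (no_types, lifting) Suc_pred' binomial_absorption diff_Suc_1 zero_less_card_finite)
  then have "real (Suc k) * real (?n choose Suc k) = (real ?n - real k) * real (?n choose k)"
    using assms by (metis less_imp_le_nat of_nat_diff of_nat_mult)
  moreover have "real (?n choose Suc k) > 0" "real (?n choose k) > 0" using assms by auto
  ultimately have "real ?n - real k = real (Suc k) * real (?n choose Suc k) / real (?n choose k)"
    by (simp add: eq_divide_eq)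
  then show ?thesis
    using \<open>real (?n choose Suc k) > 0\<close> unfolding subset_average_def sum_subsets_Suc by simp
qed

text \<open>Markov's inequality; both tail estimates below rest on it.\<close>

lemma prob_le_subset_average:
  fixes F :: "'n::finite set \<Rightarrow> real"
  assumes "k \<le> CARD('n)" "0 < a" "\<And>J. card J = k \<Longrightarrow> 0 \<le> F J"
    and "\<And>J. card J = k \<Longrightarrow> J \<in> E \<Longrightarrow> a \<le> F J"
  shows "measure_pmf.prob (pmf_of_set {J :: 'n set. card J = k}) E \<le> subset_average k F / a"
proof -
  let ?S = "{J :: 'n set. card J = k}"
  have c: "card ?S = CARD('n) choose k" by (rule card_subsets_UNIV)
  have ne: "?S \<noteq> {}" using assms(1) by (rule subsets_card_nonempty)
  have "a * card (?S \<inter> E) = (\<Sum>J\<in>?S \<inter> E. a)" by simp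
  also have "\<dots> \<le> (\<Sum>J\<in>?S \<inter> E. F J)" using assms(4) by (intro sum_mono) auto
  also have "\<dots> \<le> (\<Sum>J\<in>?S. F J)" using assms(3) by (intro sum_mono2) auto
  finally have "card (?S \<inter> E) \<le> (\<Sum>J\<in>?S. F J) / a"
    using assms(2) by (simp add: field_simps)
  then have "card (?S \<inter> E) / (CARD('n) choose k) \<le> (\<Sum>J\<in>?S. F J) / a / (CARD('n) choose k)"
    by (rule divide_right_mono) simp
  then show ?thesis
    using ne by (simp add: measure_pmf_of_set subset_average_def c mult.commute)
qed

text \<open>By symmetry each index is left out with probability \<open>(n - k) / n\<close>. In the
  induction, every term still unsampled survives all but one of the possible next choices.\<close>

lemma subset_average_sum_Compl:
  fixes g :: "'n::finite \<Rightarrow> real"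
  assumes "k \<le> CARD('n)"
  shows "CARD('n) * subset_average k (\<lambda>J. \<Sum>i\<in>-J. g i) = (real CARD('n) - real k) * (\<Sum>i\<in>UNIV. g i)"
  using assms
proof (induction k)
  case 0
  then show ?case by (simp add: subset_average_0)
next
  case (Suc k)
  have *: "(\<Sum>i\<in>-J. \<Sum>l\<in>-insert i J. g l) = (real CARD('n) - real k - 1) * (\<Sum>i\<in>-J. g i)"
    if "card J = k" for J :: "'n set"
  proof -
    have "(\<Sum>l\<in>-insert i J. g l) = (\<Sum>l\<in>-J. g l) - g i" if "i \<in> -J" for i
    proof -
      have "- insert i J = - J - {i}" by auto
      then show ?thesis using that by (simp add: sum_diff1)
    qed
    then have "(\<Sum>i\<in>-J. \<Sum>l\<in>-insert i J. g l) = (\<Sum>i\<in>-J. (\<Sum>l\<in>-J. g l) - g i)" by simp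
    also have "\<dots> = (real (card (-J)) - 1) * (\<Sum>i\<in>-J. g i)"
      by (simp add: sum_subtractf algebra_simps)
    also have "real (card (-J)) = real CARD('n) - real k"
      using that Suc.prems by (simp add: of_nat_card_Compl)
    finally show ?thesis .
  qed
  have "(real CARD('n) - real k) * subset_average (Suc k) (\<lambda>J. \<Sum>i\<in>-J. g i)
      = subset_average k (\<lambda>J. (real CARD('n) - real k - 1) * (\<Sum>i\<in>-J. g i))"
    using Suc.prems * by (subst subset_average_Suc) (auto simp: subset_average_def)
  also have "\<dots> = (real CARD('n) - real k - 1) * subset_average k (\<lambda>J. \<Sum>i\<in>-J. g i)"
    by (rule subset_average_cmult)
  finally have "(real CARD('n) - real k) * (CARD('n) * subset_average (Suc k) (\<lambda>J. \<Sum>i\<in>-J. g i))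
      = (real CARD('n) - real k - 1) * (CARD('n) * subset_average k (\<lambda>J. \<Sum>i\<in>-J. g i))"
    by (metis mult.left_commute)
  then have "(real CARD('n) - real k) * (CARD('n) * subset_average (Suc k) (\<lambda>J. \<Sum>i\<in>-J. g i))
      = (real CARD('n) - real k) * ((real CARD('n) - real k - 1) * (\<Sum>i\<in>UNIV. g i))"
    using Suc by simp
  then show ?case using Suc.prems by simp
qed

text \<open>Without replacement the terms of a centred family are negatively correlated, so the cross
  terms can be dropped.\<close>

lemma subset_average_norm_sum_le:
  fixes g :: "'n::finite \<Rightarrow> 'a::real_inner"
  assumes "k \<le> CARD('n)" and zero: "(\<Sum>i\<in>UNIV. g i) = 0"
  shows "subset_average k (\<lambda>J. (norm (\<Sum>i\<in>J. g i))\<^sup>2)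
    \<le> real k / CARD('n) * (\<Sum>i\<in>UNIV. (norm (g i))\<^sup>2)"
  using assms(1)
proof (induction k)
  case 0
  then show ?case by (simp add: subset_average_0)
next
  case (Suc k)
  let ?n = "real CARD('n)" and ?G = "\<lambda>J. \<Sum>i\<in>-J. (norm (g i))\<^sup>2"
  let ?F = "\<lambda>J. (norm (\<Sum>i\<in>J. g i))\<^sup>2" and ?T = "\<Sum>i\<in>UNIV. (norm (g i))\<^sup>2"
  have nk: "?n - k > 0" using Suc.prems by simp
  have *: "(\<Sum>i\<in>-J. ?F (insert i J)) \<le> (?n - k) * ?F J + ?G J" if "card J = k" for J :: "'n set"
  proof -
    let ?s = "\<Sum>i\<in>J. g i"
    have "(\<Sum>i\<in>-J. ?F (insert i J)) = (\<Sum>i\<in>-J. ?F J + 2 * (?s \<bullet> g i) + (norm (g i))\<^sup>2)"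
      by (intro sum.cong) (auto simp: power2_norm_eq_inner inner_add_left inner_add_right inner_commute)
    also have "\<dots> = card (-J) * ?F J + 2 * (?s \<bullet> (\<Sum>i\<in>-J. g i)) + ?G J"
      by (simp add: sum.distrib inner_sum_right flip: sum_distrib_left)
    \<comment> \<open>Centring turns the cross term into minus twice the squared norm of
      \<open>?s\<close>, which is then dropped as nonpositive.\<close>
    also have "(\<Sum>i\<in>-J. g i) = - ?s"
    proof -
      have "(\<Sum>i\<in>-J. g i) + ?s = (\<Sum>i\<in>UNIV. g i)"
        using sum.subset_diff[of J UNIV g] by (simp add: Compl_eq_Diff_UNIV)
      then show ?thesis using zero by (simp add: eq_neg_iff_add_eq_0)
    qed
    also have "real (card (-J)) = ?n - k"
      using that Suc.prems by (simp add: of_nat_card_Compl)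
    finally show ?thesis by simp
  qed
  have "(?n - k) * subset_average (Suc k) ?F = subset_average k (\<lambda>J. \<Sum>i\<in>-J. ?F (insert i J))"
    using Suc.prems by (intro subset_average_Suc) simp
  also have "\<dots> \<le> subset_average k (\<lambda>J. (?n - k) * ?F J + ?G J)"
    by (rule subset_average_mono) (rule *)
  also have "\<dots> = (?n - k) * subset_average k ?F + subset_average k ?G"
    by (simp add: subset_average_add subset_average_cmult)
  also have "subset_average k ?G = (?n - k) * (?T / ?n)"
    using subset_average_sum_Compl[of k "\<lambda>i. (norm (g i))\<^sup>2"] Suc.prems by (simp add: field_simps)
  also have "(?n - k) * subset_average k ?F \<le> (?n - k) * (k / ?n * ?T)"
    using Suc nk by (intro mult_left_mono) auto
  finally have "(?n - k) * subset_average (Suc k) ?F \<le> (?n - k) * (k / ?n * ?T + ?T / ?n)"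
    by (simp add: algebra_simps)
  then have "subset_average (Suc k) ?F \<le> k / ?n * ?T + ?T / ?n"
    using nk by (simp add: mult_le_cancel_left_pos)
  then show ?case by (simp add: field_simps)
qed

subsection \<open>The smallest eigenvalue of a sampled Gram matrix\<close>

lemma inner_sum_outer: "x \<bullet> ((\<Sum>i\<in>I. outer (f i)) *v x) = (\<Sum>i\<in>I. (f i \<bullet> x)\<^sup>2)"
  by (simp add: sum_mult_vec outer_mult_vec inner_sum_right power2_eq_square inner_commute)

lemma psd_sum_outer: "psd (\<Sum>i\<in>I. outer (f i))"
  by (simp add: psd_def transpose_sum transpose_outer inner_sum_outer sum_nonneg)

lemma sum_outer_rows: "(\<Sum>i\<in>UNIV. outer (row i U)) = transpose U ** U"
  by (simp add: vec_eq_iff outer_def row_def matrix_matrix_mult_def transpose_def)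

lemma row_inner: "row i A \<bullet> x = (A *v x) $ i"
  by (simp add: matrix_vector_mult_def row_def inner_vec_def)

text \<open>Written as a sum over the unsampled rows, so that it is visibly positive semidefinite
  and loses one \<open>outer\<close> term with each sampled row. For orthonormal columns it is the
  identity minus the sampled Gram matrix.\<close>

definition residual_gram :: "real^'d^'n \<Rightarrow> 'n set \<Rightarrow> real^'d^'d" where
  "residual_gram U J = (\<Sum>i\<in>-J. outer (row i U))"

lemma psd_residual_gram: "psd (residual_gram U J)"
  unfolding residual_gram_def by (rule psd_sum_outer)

lemma residual_gram_insert:
  assumes "i \<notin> J"
  shows "residual_gram U J = residual_gram U (insert i J) + outer (row i U)"
proof -
  have "- J = insert i (- insert i J)" using assms by auto
  then show ?thesis by (simp add: residual_gram_def add.commute)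
qed

lemma sum_inner_mat_power_residual_gram:
  "(\<Sum>i\<in>-J. row i U \<bullet> (mat_power (residual_gram U J) k *v row i U))
    = trace (mat_power (residual_gram U J) (Suc k))"
proof -
  have "(\<Sum>i\<in>-J. row i U \<bullet> (mat_power (residual_gram U J) k *v row i U))
      = trace (residual_gram U J ** mat_power (residual_gram U J) k)"
    unfolding residual_gram_def[of U J] sum_matrix_mult trace_sum trace_outer_mult ..
  then show ?thesis by simp
qed

text \<open>Since the rows that are not yet sampled add up to the residual Gram matrix itself, summing the
  first-order decrease over the next row reproduces the potential.\<close>

lemma sum_trace_residual_gram_insert:
  fixes U :: "real^'d^'n" and J :: "'n set" and b :: real
  assumes b: "\<And>i. (norm (row i U))\<^sup>2 \<le> b" and m: "2 \<le> m" "real m * b \<le> 1 / 8"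
  shows "(\<Sum>i\<in>-J. trace (mat_power (residual_gram U (insert i J)) m))
    \<le> (real CARD('n) - real (card J) - 3 / 4 * m) * trace (mat_power (residual_gram U J) m)
      + m / 4 * (CARD('d) / 4 ^ m)"
proof -
  obtain p where p: "m = Suc (Suc p)" using m(1) by (metis Suc_le_D numeral_2_eq_2 Suc_le_mono)
  let ?N = "residual_gram U J"
  let ?t = "\<lambda>k. trace (mat_power ?N k)"
  have b0: "0 \<le> b" using b[of undefined] by (smt (verit) zero_le_power2)
  have "(\<Sum>i\<in>-J. trace (mat_power (residual_gram U (insert i J)) m))
      \<le> (\<Sum>i\<in>-J. ?t m - real m * (row i U \<bullet> (mat_power ?N (Suc p) *v row i U))
            + real m * real (Suc p) / 2 * b * (row i U \<bullet> (mat_power ?N p *v row i U)))"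
    unfolding p using b
    by (intro sum_mono trace_mat_power_rank_one_update psd_residual_gram residual_gram_insert)
      (auto simp: power2_norm_eq_inner)
  also have "\<dots> = card (-J) * ?t m - real m * ?t m + real m * real (Suc p) / 2 * b * ?t (Suc p)"
    by (simp only: sum.distrib sum_subtractf sum_constant sum_inner_mat_power_residual_gram p
        flip: sum_distrib_left)
  also have "real m * real (Suc p) / 2 * b * ?t (Suc p) = real m * (real (Suc p) / 2 * b * ?t (Suc p))"
    by (simp only: times_divide_eq_left times_divide_eq_right mult.assoc)
  also have "card (-J) * ?t m - real m * ?t m + real m * (real (Suc p) / 2 * b * ?t (Suc p))
      \<le> card (-J) * ?t m - real m * ?t m + real m * (?t m / 4 + (CARD('d) / 4 ^ m) / 4)"
  proof -
    \<comment> \<open>Here \<open>real m * b \<le> 1 / 8\<close> makes the coefficient at most 1/16.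
      With the factor 4 from lowering the exponent, the second-order term gives back only a quarter
      of the first-order decrease, which leaves the rate 3/4.\<close>
    have "real (Suc p) / 2 * b * ?t (Suc p) \<le> 1 / 16 * (4 * ?t m + CARD('d) / 4 ^ Suc p)"
    proof (rule mult_mono)
      have "real (Suc p) * b \<le> real m * b" using b0 p by (intro mult_right_mono) auto
      then have "real (Suc p) * b \<le> 1 / 8" using m(2) by linarith
      then show "real (Suc p) / 2 * b \<le> 1 / 16" by linarith
      show "?t (Suc p) \<le> 4 * ?t m + CARD('d) / 4 ^ Suc p"
        unfolding p by (rule trace_mat_power_pred_le[OF psd_residual_gram])
    qed (simp_all add: trace_mat_power_nonneg psd_residual_gram del: mat_power.simps)
    also have "\<dots> = ?t m / 4 + (CARD('d) / 4 ^ m) / 4"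
      unfolding p by (simp add: field_simps)
    finally show ?thesis by (intro add_left_mono mult_left_mono) auto
  qed
  finally show ?thesis
    by (simp add: of_nat_card_Compl algebra_simps)
qed

text \<open>The potential starts at the trace of the identity. Each step contracts it by
  \<open>1 - 3 * m / (4 * (n - k))\<close>, which is at most \<open>1 - m / (2 * n)\<close>, and the
  additive term is large enough to reproduce itself under the recursion.\<close>

lemma subset_average_trace_residual_gram:
  fixes U :: "real^'d^'n" and b :: real
  assumes U: "transpose U ** U = mat 1"
    and b: "\<And>i. (norm (row i U))\<^sup>2 \<le> b" and m: "2 \<le> m" "real m * b \<le> 1 / 8" "m \<le> CARD('n)"
    and "k \<le> CARD('n)"
  shows "subset_average k (\<lambda>J. trace (mat_power (residual_gram U J) m))
    \<le> CARD('d) * (1 - m / (2 * real CARD('n))) ^ k + m * (CARD('d) / 4 ^ m)"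
  using assms(6)
proof (induction k)
  case 0
  have "residual_gram U {} = mat 1"
    by (simp add: residual_gram_def sum_outer_rows U)
  moreover have "mat_power (mat 1) m = (mat 1 :: real^'d^'d)" for m
    by (induction m) auto
  ultimately show ?case by (simp add: subset_average_0 trace_I)
next
  case (Suc k)
  let ?n = "real CARD('n)" and ?d = "real CARD('d)"
  let ?F = "\<lambda>J. trace (mat_power (residual_gram U J) m)"
  define t where "t = ?d / 4 ^ m"
  define q where "q = 1 - m / (2 * ?n)"
  have t0: "0 \<le> t" by (simp add: t_def)
  have q0: "0 \<le> q" using m(3) by (simp add: q_def field_simps)
  have nk: "1 \<le> ?n - k" using Suc.prems by linarith
  have step: "(?n - k) * subset_average (Suc k) ?F
      \<le> (?n - k - 3 / 4 * m) * subset_average k ?F + m / 4 * t"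
  proof -
    have "(?n - k) * subset_average (Suc k) ?F = subset_average k (\<lambda>J. \<Sum>i\<in>-J. ?F (insert i J))"
      using Suc.prems by (intro subset_average_Suc) simp
    also have "\<dots> \<le> subset_average k (\<lambda>J. (?n - k - 3 / 4 * m) * ?F J + m / 4 * t)"
      unfolding t_def using sum_trace_residual_gram_insert[OF b m(1,2)]
      by (intro subset_average_mono) metis
    also have "\<dots> = (?n - k - 3 / 4 * m) * subset_average k ?F + m / 4 * t"
      using Suc.prems by (simp add: subset_average_add subset_average_cmult subset_average_const)
    finally show ?thesis .
  qed
  \<comment> \<open>The induction hypothesis may be multiplied by the coefficient only if that is
    nonnegative. When fewer than \<open>3 / 4 * m\<close> rows remain, the product is nonpositive
    and the source term alone fits into the additive error.\<close>
  have "(?n - k) * subset_average (Suc k) ?F \<le> (?n - k) * (?d * q ^ Suc k + m * t)"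
  proof (cases "0 \<le> ?n - k - 3 / 4 * m")
    case True
    have 1: "(?n - k - 3 / 4 * m) * subset_average k ?F
        \<le> (?n - k - 3 / 4 * m) * (?d * q ^ k) + (?n - k - 3 / 4 * m) * (m * t)"
      using Suc True unfolding q_def t_def distrib_left[symmetric] by (intro mult_left_mono) auto
    have "(?n - k) * (m / (2 * ?n)) \<le> ?n * (m / (2 * ?n))"
      by (intro mult_right_mono) auto
    also have "\<dots> = m / 2" by simp
    finally have "(?n - k) * (m / (2 * ?n)) \<le> 3 / 4 * m" by linarith
    then have "?n - k - 3 / 4 * m \<le> (?n - k) * q" by (simp add: q_def right_diff_distrib)
    then have 2: "(?n - k - 3 / 4 * m) * (?d * q ^ k) \<le> ((?n - k) * q) * (?d * q ^ k)"
      using q0 by (intro mult_right_mono) auto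
    \<comment> \<open>The contraction of the additive error pays for the new source term, since
      \<open>m\<close> is at least 1.\<close>
    have "1 / 4 * (m * t) \<le> (3 / 4 * m) * (m * t)"
      using t0 m(1) by (intro mult_right_mono) auto
    then have 3: "(?n - k - 3 / 4 * m) * (m * t) + m / 4 * t \<le> (?n - k) * (m * t)"
      by (simp add: algebra_simps)
    show ?thesis using step 1 2 3 by (simp add: algebra_simps)
  next
    case False
    have "0 \<le> subset_average k ?F"
      by (simp add: subset_average_def sum_nonneg trace_mat_power_nonneg psd_residual_gram)
    then have "(?n - k - 3 / 4 * m) * subset_average k ?F \<le> 0"
      using False by (intro mult_nonpos_nonneg) auto
    moreover have "m / 4 * t \<le> (?n - k) * (m * t)"
    proof -
      have "0 \<le> m * t" using t0 by simp
      moreover from this have "1 * (m * t) \<le> (?n - k) * (m * t)" using nk by (rule mult_right_mono[rotated])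
      moreover have "m / 4 * t = m * t / 4" by simp
      ultimately show ?thesis by linarith
    qed
    moreover have "0 \<le> (?n - k) * (?d * q ^ Suc k)" using nk q0 by simp
    ultimately show ?thesis using step by (simp add: distrib_left)
  qed
  then show ?case using nk unfolding q_def t_def by simp
qed

section \<open>Lower tail of the sampled Gram matrix\<close>

lemma exp_minus_double_le:
  fixes x :: real
  assumes "0 \<le> x" "x \<le> 1 / 2"
  shows "exp (- (2 * x)) \<le> 1 - x"
proof -
  have "x * x \<le> x * (1 / 2)" using assms by (intro mult_left_mono) auto
  then have "- (2 * x) \<le> - x - 2 * x\<^sup>2" by (simp add: power2_eq_square)
  also have "\<dots> \<le> ln (1 - x)" using assms by (intro ln_one_minus_pos_lower_bound) auto
  finally show ?thesis using assms by (simp add: ln_ge_iff)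
qed

text \<open>Markov's inequality for the potential, with \<open>r = c / n\<close>. On the bad event
  it is at least \<open>(1 - r / 8) ^ m\<close>, hence at least \<open>exp (- (m * r / 4))\<close>,
  while its mean is at most \<open>2 * d * exp (- (m * r / 2))\<close>. The quotient is small
  because \<open>m * r / 4\<close> exceeds \<open>ln d + 7\<close>.\<close>

lemma prob_sampled_gram_small:
  fixes U :: "real^'d^'n" and b :: real
  assumes U: "transpose U ** U = mat 1" and b: "\<And>i. (norm (row i U))\<^sup>2 \<le> b"
    and c: "c \<le> CARD('n)" "real c \<ge> 1000 * (real CARD('n) * b) * (ln (real CARD('d)) + 7)"
  shows "measure_pmf.prob (pmf_of_set {J :: 'n set. card J = c})
      {J. \<exists>x. norm x = 1 \<and> (\<Sum>i\<in>J. (row i U \<bullet> x)\<^sup>2) < c / (8 * real CARD('n))} \<le> 2 * exp (-7)"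
proof -
  let ?n = "real CARD('n)" and ?d = "real CARD('d)"
  have d1: "1 \<le> ?d" by (simp add: Suc_le_eq)
  have n1: "1 \<le> ?n" by (simp add: Suc_le_eq)
  have ln0: "0 \<le> ln ?d" using d1 by simp
  \<comment> \<open>The squared row norms add up to the trace of the identity, so \<open>b\<close>
    is at least their mean \<open>d / n\<close>.\<close>
  have nb: "?d \<le> ?n * b"
  proof -
    have "?d = trace (transpose U ** U)" by (simp add: U trace_I)
    also have "\<dots> = (\<Sum>i\<in>UNIV. (norm (row i U))\<^sup>2)"
      by (simp add: trace_sum trace_outer power2_norm_eq_inner flip: sum_outer_rows)
    also have "\<dots> \<le> (\<Sum>i\<in>(UNIV :: 'n set). b)" using b by (intro sum_mono) auto
    finally show ?thesis by simp
  qed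
  then have b0: "0 < b" using d1 n1 by (smt (verit) mult_nonneg_nonpos)
  have c1000: "1000 * (?n * b) * 7 \<le> 1000 * (?n * b) * (ln ?d + 7)"
    using b0 n1 ln0 by (intro mult_left_mono) auto
  then have "1000 * (?n * b) * 7 \<le> ?n" using c by linarith
  then have "?n * (7000 * b) \<le> ?n * 1" by linarith
  then have bs: "7000 * b \<le> 1" using n1 by (simp add: mult_le_cancel_left_pos)
  \<comment> \<open>The largest exponent with \<open>m * b \<le> 1 / 8\<close>, as the one-step
    estimate demands. Since \<open>1 / (8 * b)\<close> is at least 2, rounding down loses at most
    half of it.\<close>
  define m where "m = nat \<lfloor>1 / (8 * b)\<rfloor>"
  have "2 \<le> 1 / (8 * b)" using b0 bs by (simp add: field_simps)
  then have m_le: "real m \<le> 1 / (8 * b)" and m_ge: "1 / (16 * b) \<le> real m" and m2: "2 \<le> m"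
    unfolding m_def by (linarith | (simp add: le_nat_floor le_floor_iff; fail) | (simp; linarith))+
  have mb: "real m * b \<le> 1 / 8" using m_le b0 by (simp add: field_simps)
  have "1 \<le> ?n * (8 * b)" using nb d1 by linarith
  then have "1 / (8 * b) \<le> ?n" using b0 by (simp add: divide_le_eq)
  then have mn: "m \<le> CARD('n)" using m_le by linarith
  define r where "r = c / ?n"
  have r: "0 \<le> r" "r \<le> 1" using c(1) by (auto simp: r_def)
  define s where "s = 1 - r / 8"
  have s: "exp (- (r / 4)) \<le> s" using exp_minus_double_le[of "r / 8"] r by (simp add: s_def)
  then have s_pos: "0 < s" by (smt (verit) exp_gt_zero)
  let ?F = "\<lambda>J. trace (mat_power (residual_gram U J) m)"
  let ?E = "{J. \<exists>x. norm x = 1 \<and> (\<Sum>i\<in>J. (row i U \<bullet> x)\<^sup>2) < c / (8 * real CARD('n))}"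
  have "measure_pmf.prob (pmf_of_set {J :: 'n set. card J = c}) ?E \<le> subset_average c ?F / s ^ m"
  proof (rule prob_le_subset_average)
    fix J assume "J \<in> ?E"
    then obtain x where x: "norm x = 1" "(\<Sum>i\<in>J. (row i U \<bullet> x)\<^sup>2) < r / 8"
      by (auto simp: r_def mult.commute)
    have "x \<bullet> (residual_gram U J *v x) + (\<Sum>i\<in>J. (row i U \<bullet> x)\<^sup>2) = x \<bullet> ((transpose U ** U) *v x)"
      unfolding residual_gram_def inner_sum_outer sum_outer_rows[symmetric]
      using sum.subset_diff[of J UNIV "\<lambda>i. (row i U \<bullet> x)\<^sup>2"] by (simp add: Compl_eq_Diff_UNIV)
    also have "\<dots> = 1" using x by (simp add: U dot_square_norm)
    finally have "s \<le> x \<bullet> (residual_gram U J *v x)" using x by (simp add: s_def)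
    then show "s ^ m \<le> ?F J"
      using x s_pos by (intro quadratic_form_le_trace psd_residual_gram) auto
  qed (use c s_pos in \<open>auto intro: trace_mat_power_nonneg psd_residual_gram\<close>)
  also have "\<dots> \<le> (2 * ?d * exp (- (m * r / 2))) / exp (- (m * r / 4))"
  proof (rule frac_le)
    have "(1 - m / (2 * ?n)) ^ c \<le> exp (- (m / (2 * ?n))) ^ c"
      using mn exp_ge_add_one_self[of "- (m / (2 * ?n))"] by (intro power_mono) (auto simp: field_simps)
    also have "\<dots> = exp (- (m * r / 2))"
      by (simp add: r_def exp_of_nat_mult[symmetric] mult_ac)
    finally have 1: "?d * (1 - m / (2 * ?n)) ^ c \<le> ?d * exp (- (m * r / 2))"
      by (intro mult_left_mono) auto
    \<comment> \<open>The additive error is at most \<open>d / 2 ^ m\<close>. As 2 is at least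
      \<open>exp (1 / 2)\<close> and \<open>r\<close> at most 1, it does not exceed the main term,
      whence the factor 2.\<close>
    have "exp (m / 2) = exp (1 / 2) ^ m" by (simp add: exp_of_nat_mult[symmetric])
    also have "\<dots> \<le> 2 ^ m" using exp_half_le2 by (intro power_mono) auto
    finally have "1 / 2 ^ m \<le> exp (- (m / 2))"
      by (simp add: exp_minus field_simps)
    also have "\<dots> \<le> exp (- (m * r / 2))"
      using mult_left_mono[OF r(2), of "real m"] by simp
    finally have 2: "1 / 2 ^ m \<le> exp (- (m * r / 2))" .
    have "real m \<le> 2 ^ m" by (metis less_exp less_imp_le of_nat_le_iff of_nat_numeral of_nat_power)
    then have "real m / 4 ^ m \<le> 2 ^ m / 4 ^ m" by (rule divide_right_mono) simp
    also have "\<dots> = 1 / 2 ^ m" by (simp add: field_simps flip: power_mult_distrib)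
    finally have "?d * (m / 4 ^ m) \<le> ?d * exp (- (m * r / 2))"
      using 2 by (intro mult_left_mono) auto
    then have "m * (?d / 4 ^ m) \<le> ?d * exp (- (m * r / 2))" by (simp add: mult.commute)
    then show "subset_average c ?F \<le> 2 * ?d * exp (- (m * r / 2))"
      using 1 subset_average_trace_residual_gram[OF U b m2 mb mn c(1)] by linarith
    have "exp (- (m * r / 4)) = exp (- (r / 4)) ^ m"
      by (simp add: exp_of_nat_mult[symmetric])
    also have "\<dots> \<le> s ^ m" using s by (intro power_mono) auto
    finally show "exp (- (m * r / 4)) \<le> s ^ m" .
  qed auto
  also have "\<dots> = 2 * ?d * exp (- (m * r / 4))"
    by (simp add: exp_diff[symmetric] flip: times_divide_eq_right)
  also have "\<dots> \<le> 2 * ?d * exp (- (ln ?d + 7))"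
  proof -
    \<comment> \<open>With \<open>m\<close> at least \<open>1 / (16 * b)\<close>, the exponent is at
      least \<open>r / b\<close> divided by 64, and 1000/64 is more than 1.\<close>
    have "1000 * (ln ?d + 7) \<le> r / b"
      using c(2) b0 n1 by (simp add: r_def field_simps)
    moreover have "r / b / 64 \<le> m * r / 4"
      using mult_right_mono[OF m_ge, of "r / 4"] r by simp
    ultimately have "ln ?d + 7 \<le> m * r / 4" using ln0 by argo
    then show ?thesis by simp
  qed
  also have "\<dots> = 2 * exp (-7)"
    using d1 by (simp add: exp_diff exp_minus field_simps exp_add)
  finally show ?thesis .
qed

subsection \<open>Least squares and the singular value decomposition\<close>

text \<open>The enumeration picked by the choice operator disappears by reindexing the sum, so from
  here on only the set \<open>J\<close> matters.\<close>

lemma sampling_matrix_inner: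
  fixes J :: "'n::finite set" and v w :: "real^'n"
  assumes "card J = CARD('c::finite)"
  shows "((sampling_matrix J :: real^'n^'c) *v v) \<bullet> (sampling_matrix J *v w) = (\<Sum>i\<in>J. v $ i * w $ i)"
proof -
  define f where "f = (SOME f. bij_betw f (UNIV :: 'c set) J)"
  have "\<exists>f. bij_betw f (UNIV :: 'c set) J" using assms by (intro finite_same_card_bij) auto
  then have f: "bij_betw f (UNIV :: 'c set) J" unfolding f_def by (rule someI_ex)
  have S: "((sampling_matrix J :: real^'n^'c) *v x) $ k = x $ f k" for x k
  proof -
    have "((sampling_matrix J :: real^'n^'c) *v x) $ k = row (f k) (mat 1) \<bullet> x"
      by (simp add: sampling_matrix_def Let_def f_def matrix_vector_mult_def inner_vec_def)
    then show ?thesis by (simp add: row_inner)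
  qed
  show ?thesis
    unfolding inner_vec_def S using sum.reindex_bij_betw[OF f, of "\<lambda>i. v $ i * w $ i"] by simp
qed

lemma lsq_solution_normal_equation:
  assumes "lsq_solution A b \<beta>"
  shows "(b - A *v \<beta>) \<bullet> (A *v z) = 0"
proof (cases "A *v z = 0")
  case False
  \<comment> \<open>The minimizer of the objective along the line through \<open>\<beta>\<close> in
    direction \<open>z\<close>; optimality of \<open>\<beta>\<close> forces it to be 0.\<close>
  define t where "t = ((b - A *v \<beta>) \<bullet> (A *v z)) / ((A *v z) \<bullet> (A *v z))"
  have pos: "0 < (A *v z) \<bullet> (A *v z)" using False by simp
  have "b - A *v (\<beta> + t *\<^sub>R z) = (b - A *v \<beta>) - t *\<^sub>R (A *v z)"
    by (simp add: matrix_vector_right_distrib matrix_vector_mult_scaleR)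
  moreover have "(norm (b - A *v \<beta>))\<^sup>2 \<le> (norm (b - A *v (\<beta> + t *\<^sub>R z)))\<^sup>2"
    using assms by (simp add: lsq_solution_def is_arg_min_def not_less)
  ultimately have "2 * t * ((b - A *v \<beta>) \<bullet> (A *v z)) \<le> t * t * ((A *v z) \<bullet> (A *v z))"
    by (simp add: power2_norm_eq_inner inner_diff_left inner_diff_right inner_commute algebra_simps)
  moreover have "(b - A *v \<beta>) \<bullet> (A *v z) = t * ((A *v z) \<bullet> (A *v z))"
    using pos by (simp add: t_def)
  ultimately have "t * t * ((A *v z) \<bullet> (A *v z)) \<le> 0" by simp
  then have "t = 0" using pos by (auto simp: mult_le_0_iff)
  then show ?thesis using pos by (simp add: t_def)
qed simp

lemma thin_svd_mult:
  assumes "thin_svd X U \<Sigma> V"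
  shows "X *v \<beta> = U *v (\<Sigma> *v (transpose V *v \<beta>))"
  using assms by (simp add: thin_svd_def flip: matrix_vector_mul_assoc)

lemma orthonormal_columns_inner:
  fixes U :: "real^'d^'n"
  assumes "transpose U ** U = mat 1"
  shows "(U *v v) \<bullet> (U *v w) = v \<bullet> w"
proof -
  have "(U *v v) \<bullet> (U *v w) = (transpose U *v (U *v v)) \<bullet> w"
    by (simp add: dot_lmul_matrix)
  also have "\<dots> = v \<bullet> w" by (simp add: assms matrix_vector_mul_assoc del: transpose_matrix_vector)
  finally show ?thesis .
qed

lemma diagonal_mult_vec:
  fixes \<Sigma> :: "real^'d^'d"
  assumes "\<forall>i j. i \<noteq> j \<longrightarrow> \<Sigma> $ i $ j = 0"
  shows "(\<Sigma> *v z) $ i = \<Sigma> $ i $ i * z $ i"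
proof -
  have "(\<Sigma> *v z) $ i = (\<Sum>j\<in>UNIV. if j = i then \<Sigma> $ i $ i * z $ i else 0)"
    unfolding matrix_vector_mult_def vec_lambda_beta by (intro sum.cong) (simp_all add: assms)
  then show ?thesis by simp
qed

text \<open>A vanishing diagonal entry would put a column of \<open>V\<close> into the kernel of
  \<open>X\<close>, which is trivial by full rank.\<close>

lemma sigma_min_pos:
  fixes X :: "real^'d^'n"
  assumes svd: "thin_svd X U \<Sigma> V" and rank: "rank X = CARD('d)"
  shows "0 < sigma_min \<Sigma>"
proof -
  have S: "\<forall>i j. i \<noteq> j \<longrightarrow> \<Sigma> $ i $ j = 0" "\<And>i. 0 \<le> \<Sigma> $ i $ i" and V: "orthogonal_matrix V"
    using svd by (auto simp: thin_svd_def)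
  have "\<Sigma> $ i $ i \<noteq> 0" for i
  proof
    assume 0: "\<Sigma> $ i $ i = 0"
    have "\<Sigma> *v axis i 1 = 0"
      using 0 by (auto simp: vec_eq_iff diagonal_mult_vec[OF S(1)] axis_def)
    moreover have "transpose V *v (V *v axis i 1) = axis i 1"
      using V by (simp add: orthogonal_matrix_def matrix_vector_mul_assoc)
    ultimately have "X *v (V *v axis i 1) = 0" by (simp add: thin_svd_mult[OF svd])
    moreover have "inj ((*v) X)" using rank full_rank_injective by blast
    ultimately have "V *v axis i 1 = 0" by (metis injD matrix_vector_mult_0_right)
    then have "(axis i 1 :: real^'d) = 0"
      using \<open>transpose V *v (V *v axis i 1) = axis i 1\<close> by simp
    then show False by simp
  qed
  then have "0 < \<Sigma> $ i $ i" for i using S(2) by (simp add: order_less_le)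
  then show ?thesis by (simp add: sigma_min_def)
qed

lemma norm_diagonal_mult_bounds:
  fixes \<Sigma> :: "real^'d^'d"
  assumes diag: "\<forall>i j. i \<noteq> j \<longrightarrow> \<Sigma> $ i $ j = 0" and nonneg: "\<And>i. 0 \<le> \<Sigma> $ i $ i"
  shows "(sigma_min \<Sigma>)\<^sup>2 * (norm z)\<^sup>2 \<le> (norm (\<Sigma> *v z))\<^sup>2"
    and "(norm (\<Sigma> *v z))\<^sup>2 \<le> (sigma_max \<Sigma>)\<^sup>2 * (norm z)\<^sup>2"
proof -
  have nz: "(norm z)\<^sup>2 = (\<Sum>i\<in>UNIV. (z $ i)\<^sup>2)" for z :: "real^'d"
    unfolding power2_norm_eq_inner by (simp add: inner_vec_def power2_eq_square)
  have bounds: "0 \<le> sigma_min \<Sigma>" "sigma_min \<Sigma> \<le> \<Sigma> $ i $ i" "\<Sigma> $ i $ i \<le> sigma_max \<Sigma>" for i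
    using nonneg by (auto simp: sigma_min_def sigma_max_def)
  show "(sigma_min \<Sigma>)\<^sup>2 * (norm z)\<^sup>2 \<le> (norm (\<Sigma> *v z))\<^sup>2"
    unfolding nz sum_distrib_left diagonal_mult_vec[OF diag] power_mult_distrib
    using bounds by (intro sum_mono mult_right_mono power_mono) auto
  show "(norm (\<Sigma> *v z))\<^sup>2 \<le> (sigma_max \<Sigma>)\<^sup>2 * (norm z)\<^sup>2"
    unfolding nz sum_distrib_left diagonal_mult_vec[OF diag] power_mult_distrib
    using bounds nonneg by (intro sum_mono mult_right_mono power_mono) auto
qed

lemma thin_svd_norm_bounds:
  assumes svd: "thin_svd X U \<Sigma> V"
  shows "(sigma_min \<Sigma>)\<^sup>2 * (norm \<beta>)\<^sup>2 \<le> (norm (X *v \<beta>))\<^sup>2"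
    and "(norm (X *v \<beta>))\<^sup>2 \<le> (sigma_max \<Sigma>)\<^sup>2 * (norm \<beta>)\<^sup>2"
proof -
  have U: "transpose U ** U = mat 1" and V: "transpose (transpose V) ** transpose V = mat 1"
    and S: "\<forall>i j. i \<noteq> j \<longrightarrow> \<Sigma> $ i $ j = 0" "\<And>i. 0 \<le> \<Sigma> $ i $ i"
    using svd by (auto simp: thin_svd_def orthogonal_matrix_def)
  have "(norm (X *v \<beta>))\<^sup>2 = (norm (\<Sigma> *v (transpose V *v \<beta>)))\<^sup>2"
    by (simp add: thin_svd_mult[OF svd] power2_norm_eq_inner orthonormal_columns_inner[OF U])
  moreover have "(norm (transpose V *v \<beta>))\<^sup>2 = (norm \<beta>)\<^sup>2"
    by (simp add: power2_norm_eq_inner orthonormal_columns_inner[OF V] del: transpose_matrix_vector)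
  ultimately show "(sigma_min \<Sigma>)\<^sup>2 * (norm \<beta>)\<^sup>2 \<le> (norm (X *v \<beta>))\<^sup>2"
    "(norm (X *v \<beta>))\<^sup>2 \<le> (sigma_max \<Sigma>)\<^sup>2 * (norm \<beta>)\<^sup>2"
    using norm_diagonal_mult_bounds[OF S, of "transpose V *v \<beta>"] by auto
qed

text \<open>Full rank makes \<open>\<Sigma>\<close> invertible, so every vector
  \<open>U *v z\<close> lies in the range of \<open>X\<close>. The normal equation is applied with
  \<open>z\<close> the projected residual itself.\<close>

lemma lsq_residual_orthogonal:
  fixes X :: "real^'d^'n"
  assumes svd: "thin_svd X U \<Sigma> V" and rank: "rank X = CARD('d)" and lsq: "lsq_solution X y \<beta>"
  shows "transpose U *v (y - X *v \<beta>) = 0"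
proof -
  have S: "\<forall>i j. i \<noteq> j \<longrightarrow> \<Sigma> $ i $ j = 0" and V: "transpose V ** V = mat 1"
    using svd by (auto simp: thin_svd_def orthogonal_matrix_def)
  have pos: "\<Sigma> $ i $ i \<noteq> 0" for i
  proof -
    have "sigma_min \<Sigma> \<le> \<Sigma> $ i $ i" by (simp add: sigma_min_def)
    then show ?thesis using sigma_min_pos[OF svd rank] by linarith
  qed
  define z where "z = transpose U *v (y - X *v \<beta>)"
  \<comment> \<open>Solves \<open>\<Sigma> *v q = z\<close>, so that \<open>V *v q\<close> is a
    preimage of \<open>U *v z\<close> under \<open>X\<close>.\<close>
  define q :: "real^'d" where "q = (\<chi> i. z $ i / \<Sigma> $ i $ i)"
  have "X *v (V *v q) = U *v z"
  proof -
    have "transpose V *v (V *v q) = q" by (simp add: matrix_vector_mul_assoc V del: transpose_matrix_vector)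
    moreover have "\<Sigma> *v q = z" using pos by (simp add: vec_eq_iff diagonal_mult_vec[OF S] q_def)
    ultimately show ?thesis by (simp add: thin_svd_mult[OF svd] del: transpose_matrix_vector)
  qed
  then have "(y - X *v \<beta>) \<bullet> (U *v z) = 0" using lsq_solution_normal_equation[OF lsq, of "V *v q"] by simp
  then have "z \<bullet> z = 0" by (simp add: z_def dot_lmul_matrix)
  then show ?thesis by (simp add: z_def)
qed

section \<open>Error of the sampled solution\<close>

lemma transpose_mult_vec_eq_sum_rows:
  fixes U :: "real^'d^'n"
  shows "transpose U *v x = (\<Sum>i\<in>UNIV. x $ i *\<^sub>R row i U)"
  by (simp add: vec_eq_iff matrix_vector_mult_def transpose_def row_def mult.commute)

text \<open>The sampled normal equation tested against \<open>w\<close> equates the Gram form at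
  \<open>w\<close> with the inner product of \<open>w\<close> and the sampled gradient. The lower
  bound \<open>s\<close> and Cauchy-Schwarz then bound \<open>s * norm w\<close> by the norm of that
  gradient.\<close>

lemma sampled_error_bound:
  fixes U :: "real^'d^'n" and r :: "real^'n"
  assumes s: "0 < s" "\<And>x. norm x = 1 \<Longrightarrow> s \<le> (\<Sum>i\<in>J. (row i U \<bullet> x)\<^sup>2)"
    and normal: "(\<Sum>i\<in>J. (r - U *v w) $ i * (U *v w) $ i) = 0"
    and g: "(norm (\<Sum>i\<in>J. r $ i *\<^sub>R row i U))\<^sup>2 \<le> a * s\<^sup>2"
  shows "(norm w)\<^sup>2 \<le> a"
proof -
  let ?g = "\<Sum>i\<in>J. r $ i *\<^sub>R row i U"
  have "s * (norm w)\<^sup>2 \<le> (\<Sum>i\<in>J. (row i U \<bullet> w)\<^sup>2)"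
  proof (cases "w = 0")
    case False
    have "s \<le> (\<Sum>i\<in>J. (row i U \<bullet> (w /\<^sub>R norm w))\<^sup>2)" using False by (intro s) simp
    also have "\<dots> = (\<Sum>i\<in>J. (row i U \<bullet> w)\<^sup>2) / (norm w)\<^sup>2"
      by (simp add: power_mult_distrib power_inverse sum_distrib_left divide_inverse mult.commute)
    finally show ?thesis using False by (simp add: field_simps)
  qed simp
  also have "\<dots> = ?g \<bullet> w"
    using normal by (simp add: inner_sum_left left_diff_distrib sum_subtractf power2_eq_square
        flip: row_inner)
  also have "\<dots> \<le> norm ?g * norm w" by (rule norm_cauchy_schwarz)
  finally have "s * norm w \<le> norm ?g" 
    by (cases "w = 0") (auto simp: power2_eq_square)
  then have "(s * norm w)\<^sup>2 \<le> a * s\<^sup>2" using s(1) g by (smt (verit) norm_ge_zero mult_nonneg_nonneg power_mono)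
  then show ?thesis using s(1) by (simp add: power_mult_distrib mult.commute)
qed

text \<open>The vectors \<open>r $ i *\<^sub>R row i U\<close> sum to
  \<open>transpose U *v r\<close>, which is zero, so the second moment bound for centred families
  applies and Markov's inequality finishes.\<close>

lemma prob_sampled_residual_large:
  fixes U :: "real^'d^'n" and r :: "real^'n" and b s :: real
  assumes b: "\<And>i. (norm (row i U))\<^sup>2 \<le> b" and zero: "transpose U *v r = 0"
    and c: "c \<le> CARD('n)" and s: "0 < s"
  shows "measure_pmf.prob (pmf_of_set {J :: 'n set. card J = c})
      {J. s * (norm r)\<^sup>2 < (norm (\<Sum>i\<in>J. r $ i *\<^sub>R row i U))\<^sup>2} \<le> c * b / (CARD('n) * s)"
\<comment> \<open>For \<open>r = 0\<close> the Markov level vanishes; the strict inequality makes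
  the event empty.\<close>
proof (cases "r = 0")
  case True
  have "0 \<le> b" using b[of undefined] by (smt (verit) zero_le_power2)
  then show ?thesis using True s by simp
next
  case False
  let ?F = "\<lambda>J. (norm (\<Sum>i\<in>J. r $ i *\<^sub>R row i U))\<^sup>2"
  have pos: "0 < s * (norm r)\<^sup>2" using False s by simp
  have "(\<Sum>i\<in>UNIV. (norm (r $ i *\<^sub>R row i U))\<^sup>2) \<le> (\<Sum>i\<in>UNIV. b * (r $ i)\<^sup>2)"
    using b by (intro sum_mono) (simp add: power_mult_distrib mult.commute[of b] mult_left_mono)
  also have "\<dots> = b * (norm r)\<^sup>2"
    unfolding power2_norm_eq_inner by (simp add: inner_vec_def power2_eq_square sum_distrib_left)
  finally have 1: "(\<Sum>i\<in>UNIV. (norm (r $ i *\<^sub>R row i U))\<^sup>2) \<le> b * (norm r)\<^sup>2" .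
  have "subset_average c ?F \<le> c / CARD('n) * (\<Sum>i\<in>UNIV. (norm (r $ i *\<^sub>R row i U))\<^sup>2)"
    using zero c by (intro subset_average_norm_sum_le) (auto simp: transpose_mult_vec_eq_sum_rows
        simp del: transpose_matrix_vector)
  also have "\<dots> \<le> c / CARD('n) * (b * (norm r)\<^sup>2)" using 1 by (intro mult_left_mono) auto
  finally have 2: "subset_average c ?F \<le> c / CARD('n) * (b * (norm r)\<^sup>2)" .
  have "measure_pmf.prob (pmf_of_set {J :: 'n set. card J = c}) {J. s * (norm r)\<^sup>2 < ?F J}
      \<le> subset_average c ?F / (s * (norm r)\<^sup>2)"
    using c pos by (intro prob_le_subset_average) auto
  also have "\<dots> \<le> c / CARD('n) * (b * (norm r)\<^sup>2) / (s * (norm r)\<^sup>2)"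
    using 2 pos by (intro divide_right_mono) auto
  also have "\<dots> = c * b / (CARD('n) * s)" using False s by (simp add: field_simps)
  finally show ?thesis .
qed

text \<open>The deterministic half of the argument: on any \<open>J\<close> with a well-conditioned
  Gram matrix and a small gradient, the bounds hold for every sampled minimizer.\<close>

lemma sampled_lsq_bounds:
  fixes X U :: "real^'d^'n" and J :: "'n::finite set"
  assumes rank: "rank X = CARD('d)" and svd: "thin_svd X U \<Sigma> V" and lsr: "lsq_solution X y \<beta>_lsr"
    and J: "card J = CARD('c::finite)"
    and s: "0 < s" "\<And>x. norm x = 1 \<Longrightarrow> s \<le> (\<Sum>i\<in>J. (row i U \<bullet> x)\<^sup>2)"
    and g: "(norm (\<Sum>i\<in>J. (y - X *v \<beta>_lsr) $ i *\<^sub>R row i U))\<^sup>2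
      \<le> a * s\<^sup>2 * (norm (y - X *v \<beta>_lsr))\<^sup>2"
    and lsq: "lsq_solution ((sampling_matrix J :: real^'n^'c) ** X) (sampling_matrix J *v y) \<beta>"
  shows "(norm (y - X *v \<beta>))\<^sup>2 \<le> (1 + a) * (norm (y - X *v \<beta>_lsr))\<^sup>2"
    and "(norm (\<beta>_lsr - \<beta>))\<^sup>2 \<le> a / (sigma_min \<Sigma>)\<^sup>2 * (norm (y - X *v \<beta>_lsr))\<^sup>2"
proof -
  let ?S = "sampling_matrix J :: real^'n^'c"
  have U: "transpose U ** U = mat 1" using svd by (simp add: thin_svd_def)
  define r where "r = y - X *v \<beta>_lsr"
  \<comment> \<open>The coordinates of the change in fitted values with respect to the orthonormal
    columns of \<open>U\<close>.\<close>
  define w where "w = \<Sigma> *v (transpose V *v (\<beta> - \<beta>_lsr))"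
  have Xw: "X *v (\<beta> - \<beta>_lsr) = U *v w" unfolding w_def by (rule thin_svd_mult[OF svd])
  have res: "y - X *v \<beta> = r - U *v w"
    by (simp add: r_def matrix_vector_mult_diff_distrib flip: Xw)
  have "(?S ** X) *v (\<beta> - \<beta>_lsr) = ?S *v (U *v w)"
    by (simp only: Xw flip: matrix_vector_mul_assoc)
  moreover have "?S *v y - (?S ** X) *v \<beta> = ?S *v (r - U *v w)"
    by (simp add: res[symmetric] matrix_vector_mult_diff_distrib matrix_vector_mul_assoc)
  ultimately have "(?S *v (r - U *v w)) \<bullet> (?S *v (U *v w)) = 0"
    using lsq_solution_normal_equation[OF lsq, of "\<beta> - \<beta>_lsr"] by simp
  then have normal: "(\<Sum>i\<in>J. (r - U *v w) $ i * (U *v w) $ i) = 0"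
    unfolding sampling_matrix_inner[OF J] .
  have g': "(norm (\<Sum>i\<in>J. r $ i *\<^sub>R row i U))\<^sup>2 \<le> a * (norm r)\<^sup>2 * s\<^sup>2"
    using g by (simp only: r_def mult.assoc mult.commute[of "s\<^sup>2"])
  have w: "(norm w)\<^sup>2 \<le> a * (norm r)\<^sup>2"
    by (rule sampled_error_bound[OF s(1) _ normal g']) (rule s(2))
  \<comment> \<open>The optimal residual is orthogonal to the range of \<open>U\<close>, so
    Pythagoras splits the new residual into \<open>r\<close> and \<open>U *v w\<close>.\<close>
  have "transpose U *v r = 0" unfolding r_def by (rule lsq_residual_orthogonal[OF svd rank lsr])
  then have "r \<bullet> (U *v w) = 0" by (simp flip: dot_lmul_matrix)
  then have "(norm (y - X *v \<beta>))\<^sup>2 = (norm r)\<^sup>2 + (norm (U *v w))\<^sup>2"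
    unfolding res by (simp add: power2_norm_eq_inner inner_diff_left inner_diff_right inner_commute)
  then show "(norm (y - X *v \<beta>))\<^sup>2 \<le> (1 + a) * (norm (y - X *v \<beta>_lsr))\<^sup>2"
    using w by (simp add: power2_norm_eq_inner orthonormal_columns_inner[OF U] r_def algebra_simps)
  have "(sigma_min \<Sigma>)\<^sup>2 * (norm (\<beta> - \<beta>_lsr))\<^sup>2 \<le> (norm w)\<^sup>2"
    using thin_svd_norm_bounds(1)[OF svd, of "\<beta> - \<beta>_lsr"]
    by (simp add: Xw power2_norm_eq_inner orthonormal_columns_inner[OF U])
  then show "(norm (\<beta>_lsr - \<beta>))\<^sup>2 \<le> a / (sigma_min \<Sigma>)\<^sup>2 * (norm (y - X *v \<beta>_lsr))\<^sup>2"
    using w sigma_min_pos[OF svd rank]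
    by (simp add: norm_minus_commute[of \<beta>_lsr] r_def pos_le_divide_eq mult.commute)
qed

text \<open>The projection of \<open>y\<close> is \<open>X *v \<beta>\<close>, so
  \<open>\<gamma>\<close> bounds from below the cosine of the angle between \<open>y\<close> and the
  column space. Pythagoras converts this into a bound on the residual by the fitted values, and
  \<open>sigma_max\<close> passes to the coefficients.\<close>

lemma lsq_residual_le_coefficient:
  fixes X U :: "real^'d^'n"
  assumes rank: "rank X = CARD('d)" and svd: "thin_svd X U \<Sigma> V" and lsr: "lsq_solution X y \<beta>"
    and y: "y \<noteq> 0" and \<gamma>: "0 < \<gamma>" "\<gamma> \<le> norm ((U ** transpose U) *v y) / norm y"
  shows "(norm (y - X *v \<beta>))\<^sup>2 \<le> (1 / \<gamma>\<^sup>2 - 1) * ((sigma_max \<Sigma>)\<^sup>2 * (norm \<beta>)\<^sup>2)"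
proof -
  have U: "transpose U ** U = mat 1" using svd by (simp add: thin_svd_def)
  define r where "r = y - X *v \<beta>"
  have Ur: "transpose U *v r = 0" unfolding r_def by (rule lsq_residual_orthogonal[OF svd rank lsr])
  define z where "z = \<Sigma> *v (transpose V *v \<beta>)"
  have Xz: "X *v \<beta> = U *v z" unfolding z_def by (rule thin_svd_mult[OF svd])
  have y_eq: "y = r + U *v z" by (simp add: r_def Xz)
  have "transpose U *v y = transpose U *v r + (transpose U ** U) *v z"
    unfolding y_eq by (simp only: matrix_vector_right_distrib matrix_vector_mul_assoc)
  then have proj: "(U ** transpose U) *v y = X *v \<beta>"
    by (simp add: Ur U Xz del: transpose_matrix_vector flip: matrix_vector_mul_assoc)
  have "r \<bullet> (U *v z) = 0" using Ur by (simp flip: dot_lmul_matrix)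
  then have pyth: "(norm y)\<^sup>2 = (norm r)\<^sup>2 + (norm (X *v \<beta>))\<^sup>2"
    unfolding Xz by (subst y_eq) (simp add: power2_norm_eq_inner inner_add_left inner_add_right inner_commute)
  have "\<gamma> * norm y \<le> norm (X *v \<beta>)" using \<gamma> y by (simp add: proj le_divide_eq)
  then have "(\<gamma> * norm y)\<^sup>2 \<le> (norm (X *v \<beta>))\<^sup>2" using \<gamma> by (intro power_mono) auto
  then have le: "(norm r)\<^sup>2 \<le> (1 / \<gamma>\<^sup>2 - 1) * (norm (X *v \<beta>))\<^sup>2"
    using \<gamma>(1) by (simp add: pyth power_mult_distrib field_simps)
  \<comment> \<open>This yields \<open>\<gamma> \<le> 1\<close>, so the factor
    \<open>1 / \<gamma>\<^sup>2 - 1\<close> is nonnegative and the singular value bound may be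
    multiplied by it.\<close>
  have "norm (X *v \<beta>) \<le> norm y" by (rule power2_le_imp_le) (simp_all add: pyth)
  then have "\<gamma> * norm y \<le> 1 * norm y" using \<open>\<gamma> * norm y \<le> norm (X *v \<beta>)\<close> by simp
  then have "\<gamma> \<le> 1" using y by simp
  then have "\<gamma>\<^sup>2 \<le> 1" using \<gamma>(1) by (simp add: power_le_one)
  then have "0 \<le> 1 / \<gamma>\<^sup>2 - 1" using \<gamma>(1) by simp
  from mult_left_mono[OF thin_svd_norm_bounds(2)[OF svd] this] le
  show ?thesis unfolding r_def by (rule order_trans[rotated])
qed

section \<open>Combination of the two tail bounds\<close>

theorem theorem2:
  fixes X U :: "real^'d^'n" and \<Sigma> V :: "real^'d^'d"
    and y :: "real^'n" and \<beta>_lsr :: "real^'d"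
  assumes "CARD('d) < CARD('n)"
    and "rank X = CARD('d)"
    and "thin_svd X U \<Sigma> V"
    and "y \<noteq> 0"
    and "lsq_solution X y \<beta>_lsr"
    and "CARD('c::finite) \<le> CARD('n)"
    and "real CARD('c) \<ge> 1000 * row_coherence U * real CARD('d) * (ln (real CARD('d)) + 7)"
  shows "measure_pmf.prob (pmf_of_set {J :: 'n set. card J = CARD('c)})
     {J. let S = (sampling_matrix J :: real^'n^'c) in
        \<forall>\<beta>_S. lsq_solution (S ** X) (S *v y) \<beta>_S \<longrightarrow>
          (norm (y - X *v \<beta>_S))\<^sup>2 \<le> 2.2 * (norm (y - X *v \<beta>_lsr))\<^sup>2 \<and>
          (norm (\<beta>_lsr - \<beta>_S))\<^sup>2 \<le> 1.2 / (sigma_min \<Sigma>)\<^sup>2 * (norm (y - X *v \<beta>_lsr))\<^sup>2 \<and>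
          (\<forall>\<gamma>>0. \<gamma> \<le> norm ((U ** transpose U) *v y) / norm y \<and>
                  norm ((U ** transpose U) *v y) / norm y \<le> 1 \<longrightarrow>
             1.2 / (sigma_min \<Sigma>)\<^sup>2 * (norm (y - X *v \<beta>_lsr))\<^sup>2
               \<le> 1.2 * (cond_number \<Sigma>)\<^sup>2 * (1 / \<gamma>\<^sup>2 - 1) * (norm \<beta>_lsr)\<^sup>2)}
     \<ge> 0.05"
proof -
  let ?n = "real CARD('n)" and ?c = "real CARD('c)"
  define b where "b = Max (range (\<lambda>i. (norm (row i U))\<^sup>2))"
  define r where "r = y - X *v \<beta>_lsr"
  define s where "s = ?c / (8 * ?n)"
  have U: "transpose U ** U = mat 1" using assms(3) by (simp add: thin_svd_def)
  have b: "(norm (row i U))\<^sup>2 \<le> b" for i by (simp add: b_def)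
  have b0: "0 \<le> b" using b[of undefined] by (smt (verit) zero_le_power2)
  have n0: "0 < ?n" and c0: "0 < ?c" by auto
  \<comment> \<open>The coherence times \<open>d\<close> is exactly \<open>n * b\<close>.\<close>
  have c: "1000 * (?n * b) * (ln (real CARD('d)) + 7) \<le> ?c"
    using assms(7) by (simp add: row_coherence_def b_def)
  have s0: "0 < s" using n0 c0 by (simp add: s_def)
  let ?p = "pmf_of_set {J :: 'n set. card J = CARD('c)}"
  let ?A = "{J. \<exists>x. norm x = 1 \<and> (\<Sum>i\<in>J. (row i U \<bullet> x)\<^sup>2) < s}"
  \<comment> \<open>Outside this event \<open>sampled_lsq_bounds\<close> applies with
    \<open>a = 1.2\<close>, which produces the constants 2.2 and 1.2.\<close>
  let ?B = "{J. 1.2 * s\<^sup>2 * (norm r)\<^sup>2 < (norm (\<Sum>i\<in>J. r $ i *\<^sub>R row i U))\<^sup>2}"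
  let ?E = "{J. let S = (sampling_matrix J :: real^'n^'c) in
        \<forall>\<beta>_S. lsq_solution (S ** X) (S *v y) \<beta>_S \<longrightarrow>
          (norm (y - X *v \<beta>_S))\<^sup>2 \<le> 2.2 * (norm (y - X *v \<beta>_lsr))\<^sup>2 \<and>
          (norm (\<beta>_lsr - \<beta>_S))\<^sup>2 \<le> 1.2 / (sigma_min \<Sigma>)\<^sup>2 * (norm (y - X *v \<beta>_lsr))\<^sup>2 \<and>
          (\<forall>\<gamma>>0. \<gamma> \<le> norm ((U ** transpose U) *v y) / norm y \<and>
                  norm ((U ** transpose U) *v y) / norm y \<le> 1 \<longrightarrow>
             1.2 / (sigma_min \<Sigma>)\<^sup>2 * (norm (y - X *v \<beta>_lsr))\<^sup>2
               \<le> 1.2 * (cond_number \<Sigma>)\<^sup>2 * (1 / \<gamma>\<^sup>2 - 1) * (norm \<beta>_lsr)\<^sup>2)}"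
  have A: "measure_pmf.prob ?p ?A \<le> 1 / 4"
  proof -
    have "measure_pmf.prob ?p ?A \<le> 2 * exp (-7)"
      unfolding s_def by (rule prob_sampled_gram_small[OF U b assms(6) c])
    \<comment> \<open>It suffices that \<open>exp 7\<close> is at least 1 + 7 = 8.\<close>
    also have "\<dots> \<le> 1 / 4"
      using exp_ge_add_one_self[of 7] by (simp add: exp_minus field_simps)
    finally show ?thesis .
  qed
  have B: "measure_pmf.prob ?p ?B \<le> 1 / 4"
  proof -
    have "measure_pmf.prob ?p ?B \<le> ?c * b / (?n * (1.2 * s\<^sup>2))"
      using s0 unfolding r_def
      by (intro prob_sampled_residual_large b assms(6) lsq_residual_orthogonal[OF assms(3,2,5)]) auto
    \<comment> \<open>The factor 64 is the square of the 8 in \<open>s\<close>; the quotient is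
      small because \<open>c\<close> is at least \<open>7000 * (n * b)\<close>.\<close>
    also have "\<dots> = 64 * (?n * b) / (1.2 * ?c)"
      using n0 c0 by (simp add: s_def field_simps power2_eq_square)
    also have "\<dots> \<le> 1 / 4"
    proof -
      have "1000 * (?n * b) * 7 \<le> 1000 * (?n * b) * (ln (real CARD('d)) + 7)"
        using b0 by (intro mult_left_mono) (auto simp: Suc_le_eq)
      then have "7000 * (?n * b) \<le> ?c" using c by linarith
      moreover have "0 \<le> ?n * b" using b0 by simp
      ultimately have "64 * (?n * b) \<le> 1 / 4 * (1.2 * ?c)" by linarith
      then show ?thesis using c0 by (simp only: pos_divide_le_eq[of "1.2 * ?c"])
    qed
    finally show ?thesis .
  qed
  have E: "J \<in> ?E" if J: "card J = CARD('c)" "J \<notin> ?A" "J \<notin> ?B" for J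
  proof -
    have s: "\<And>x. norm x = 1 \<Longrightarrow> s \<le> (\<Sum>i\<in>J. (row i U \<bullet> x)\<^sup>2)" using J(2) by (auto simp: not_less)
    have g: "(norm (\<Sum>i\<in>J. (y - X *v \<beta>_lsr) $ i *\<^sub>R row i U))\<^sup>2
        \<le> 1.2 * s\<^sup>2 * (norm (y - X *v \<beta>_lsr))\<^sup>2"
      using J(3) by (simp add: r_def)
    note 1 = sampled_lsq_bounds[OF assms(2,3,5) J(1) s0 s g]
    have "1.2 / (sigma_min \<Sigma>)\<^sup>2 * (norm (y - X *v \<beta>_lsr))\<^sup>2
        \<le> 1.2 * (cond_number \<Sigma>)\<^sup>2 * (1 / \<gamma>\<^sup>2 - 1) * (norm \<beta>_lsr)\<^sup>2"
      if "0 < \<gamma>" "\<gamma> \<le> norm ((U ** transpose U) *v y) / norm y" for \<gamma>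
    proof -
      have "1.2 / (sigma_min \<Sigma>)\<^sup>2 * (norm (y - X *v \<beta>_lsr))\<^sup>2
          \<le> 1.2 / (sigma_min \<Sigma>)\<^sup>2 * ((1 / \<gamma>\<^sup>2 - 1) * ((sigma_max \<Sigma>)\<^sup>2 * (norm \<beta>_lsr)\<^sup>2))"
        by (intro mult_left_mono lsq_residual_le_coefficient[OF assms(2,3,5,4) that]) auto
      also have "\<dots> = 1.2 * (cond_number \<Sigma>)\<^sup>2 * (1 / \<gamma>\<^sup>2 - 1) * (norm \<beta>_lsr)\<^sup>2"
        by (simp add: cond_number_def power_divide)
      finally show ?thesis .
    qed
    with 1 show ?thesis by (simp add: Let_def)
  qed
  have ne: "{J :: 'n set. card J = CARD('c)} \<noteq> {}"
    by (rule subsets_card_nonempty[OF assms(6)])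
  \<comment> \<open>Every sampled set is good or lies in one of the two bad events, each of
    probability at most 1/4. The union bound leaves 1/2, well above 0.05.\<close>
  then have "set_pmf ?p \<subseteq> ?E \<union> (?A \<union> ?B)" using E by (auto simp: set_pmf_of_set)
  then have "measure_pmf.prob ?p (?E \<union> (?A \<union> ?B)) = 1"
    by (subst measure_pmf.prob_eq_1) (auto simp: AE_measure_pmf_iff simp del: set_pmf_of_set)
  then have "1 \<le> measure_pmf.prob ?p (?E \<union> (?A \<union> ?B))" by simp
  also have "\<dots> \<le> measure_pmf.prob ?p ?E + measure_pmf.prob ?p (?A \<union> ?B)"
    by (rule measure_Un_le) auto
  also have "measure_pmf.prob ?p (?A \<union> ?B) \<le> measure_pmf.prob ?p ?A + measure_pmf.prob ?p ?B"
    by (rule measure_Un_le) auto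
  finally have "1 / 2 \<le> measure_pmf.prob ?p ?E" using A B by linarith
  then show ?thesis by (rule order_trans[rotated]) simp
qed

end
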